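(* Consider the differentially-private decentralized algorithm $$x_i^{k+1}=\sum_{j\in\mathbb{N}_i}w_{ij}\bigl(x_j^k-\lambda^k(g_j^k+n_j^k)\bigr),\qquad g_j^k=\nabla f_j(x_j^k),\quad i=1,\dots,m,\ k=0,1,2,\dots,$$ described in the context. Suppose that the following hold. - Regularity of the cost functions: for every $i$, $\ell_i(u,\cdot)\to\infty$ as $\|u\|\to\infty$, and for some $\nu>0,\rho>0$ (the same for all $i$): $\|\nabla \ell_i(u,\cdot)-\nabla \ell_i(v,\cdot)\|\le\nu\|u-v\|$ and $\|\nabla^2 \ell_i(u,\cdot)-\nabla^2 \ell_i(v,\cdot)\|\le\rho\|u-v\|$ for all $u,v\in\mathbb{R}^d$, and $\|\nabla\ell_i(\cdot,s_p)-\nabla\ell_i(\cdot,s_q)\|_1\le\nu\|s_p-s_q\|_1$ for all $s_p,s_q\in\mathbb{D}_i$. - Bounded gradients: there is a constant $0<G<\infty$ with $\|\nabla\ell_i(\cdot,\cdot)\|\le G$ for every $i$ (hence $\|\nabla f_i\|\le G$). - Weight matrix: $W$ is symmetric, $\mathbf{1}^TW=\mathbf{1}^T$, $W\mathbf{1}=\mathbf{1}$, and $\eta=\|W-\frac{\mathbf{1}\mathbf{1}^T}{m}\|<1$, where $\mathbf{1}$ is the all-ones column vector. - Strict saddles: all saddle points of the aggregated objective $F(\theta)=\frac1m\sum_{i=1}^m f_i(\theta)$ are strict, i.e. at every saddle point $\theta$ of $F$, the minimum eigenvalue of $\nabla^2F(\theta)$ is negative and the maximum eigenvalue is positive. Then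 the algorithm avoids saddle points of $F$ with probability at least $1-\mu$, for any $0<\mu<1$, under the following two-phase stepsize strategy: (1) a constant and small enough stepsize $\lambda^k=\lambda\le\frac1\nu$ for the first $\mathcal{O}\bigl(\frac{\log(1/\mu)}{\lambda}\bigr)$ iterates; and then (2) a diminishing stepsize $\lambda^k$ that is not summable but square summable. Explicitly: there is a constant $C>0$ such that for every $\mu\in(0,1)$ there is $\lambda_0\in(0,\frac1\nu]$ such that, for every $\lambda\in(0,\lambda_0]$, if $\lambda^k=\lambda$ for $0\le k<K:=\lceil C\log(1/\mu)/\lambda\rceil$ and $(\lambda^k)_{k\ge K}$ is a diminishing positive sequence with $\sum_{k\ge K}\lambda^k=\infty$ and $\sum_{k\ge K}(\lambda^k)^2<\infty$, then with probability at least $1-\mu$ the states $x_i^k$ ($1\le i\le m$) do not converge to a saddle point of $F$ as $k\to\infty$.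
   Context: Setting. There are $m$ agents. Agent $i$ has data samples $s_{i,1},\dots,s_{i,n_i}$ (the set of all of them is $\mathbb{D}_i$), a twice differentiable cost function $\ell_i(\theta,s)\in\mathbb{R}$, $\theta\in\mathbb{R}^d$, and the local objective $f_i(\theta)=\frac{1}{n_i}\sum_{j=1}^{n_i}\ell_i(\theta,s_{i,j})$. The symbols $\nabla \ell_i$ and $\nabla^2\ell_i$ denote the gradient and Hessian with respect to the first argument. $\|\cdot\|$ is the Euclidean norm of a vector (or the induced matrix norm), and $\|\cdot\|_1$ is the $\ell^1$ norm. Interaction graph. $W=(w_{ij})\in\mathbb{R}^{m\times m}$ is the weight matrix of an undirected interaction graph: $w_{ij}>0$ if agents $i$ and $j$ can interact, $w_{ij}=0$ otherwise, and $w_{ii}>0$ for all $i$; $\mathbb{N}_i=\{j: w_{ij}>0\}$. Saddle points. A saddle point of $F$ is a point with $\nabla F(\theta)=0$ that is neither a local minimum nor a local maximum, i.e. for every $\gamma>0$ there are $\vartheta_1,\vartheta_2$ within distance $\gamma$ of $\theta$ with $F(\vartheta_1)<F(\theta)<F(\vartheta_2)$. Algorithm. $x_i^k\in\mathbb{R}^d$ is agent $i$'s estimate at iteration $k$, with given initial values $x_i^0$ (possibly at a saddle point), and $n_j^k\in\mathbb{R}^d$ are independent (over agents $j$ and iterations $k$) Gaussian noise vectors with mean zero and covariance matrix $\sigma I_d$ ($0<\sigma<\infty$ fixed). *)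

theory Defs
  imports "HOL-Probability.Probability"
begin

text \<open>
  Gradients and Hessians are total functions; they carry information only where the
  derivatives exist (see \<open>twice_differentiable\<close> and the use of \<open>gderiv\<close> in \<open>saddle_point\<close>).
\<close>

definition gradient :: "('a::real_inner \<Rightarrow> real) \<Rightarrow> 'a \<Rightarrow> 'a" where
  "gradient f x = (THE D. GDERIV f x :> D)"

definition hessian :: "(real^'d \<Rightarrow> real) \<Rightarrow> real^'d \<Rightarrow> real^'d^'d" where
  "hessian f x = jacobian (gradient f) (at x)"

definition twice_differentiable :: "('a::real_inner \<Rightarrow> real) \<Rightarrow> bool" where
  "twice_differentiable f \<longleftrightarrow>
     (\<forall>x. f differentiable at x) \<and> (\<forall>x. gradient f differentiable at x)"

definition matrix_norm :: "real^'n^'m \<Rightarrow> real" where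
  "matrix_norm A = onorm ((*v) A)"

definition l1_norm :: "real^'n \<Rightarrow> real" where
  "l1_norm v = (\<Sum>i\<in>UNIV. \<bar>v $ i\<bar>)"

text \<open>
  The real eigenvalues. For a symmetric matrix this set is finite and nonempty, so that its \<open>Min\<close> and
  \<open>Max\<close> are the extreme eigenvalues.
\<close>

definition eigenvalues :: "real^'n^'n \<Rightarrow> real set" where
  "eigenvalues A = {c. \<exists>v. v \<noteq> 0 \<and> A *v v = c *\<^sub>R v}"

definition saddle_point :: "('a::real_inner \<Rightarrow> real) \<Rightarrow> 'a \<Rightarrow> bool" where
  "saddle_point F \<theta> \<longleftrightarrow> GDERIV F \<theta> :> 0 \<and>
     (\<forall>\<gamma>>0. \<exists>\<theta>\<^sub>1 \<theta>\<^sub>2. dist \<theta>\<^sub>1 \<theta> \<le> \<gamma> \<and> dist \<theta>\<^sub>2 \<theta> \<le> \<gamma> \<and> F \<theta>\<^sub>1 < F \<theta> \<and> F \<theta> < F \<theta>\<^sub>2)"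

definition strict_saddle :: "(real^'d \<Rightarrow> real) \<Rightarrow> real^'d \<Rightarrow> bool" where
  "strict_saddle F \<theta> \<longleftrightarrow> saddle_point F \<theta> \<and>
     Min (eigenvalues (hessian F \<theta>)) < 0 \<and> Max (eigenvalues (hessian F \<theta>)) > 0"

text \<open>
  \<open>\<Sigma>\<close> is the covariance matrix, assumed positive definite.
\<close>

definition multivariate_normal_density :: "real^'d \<Rightarrow> real^'d^'d \<Rightarrow> real^'d \<Rightarrow> real" where
  "multivariate_normal_density \<mu> \<Sigma> x =
     exp (- ((x - \<mu>) \<bullet> (matrix_inv \<Sigma> *v (x - \<mu>))) / 2) / sqrt ((2 * pi) ^ CARD('d) * det \<Sigma>)"

text \<open>
  Agent \<open>i\<close> holds the samples \<open>s i 1, \<dots>, s i (N i)\<close>.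
\<close>

definition dataset :: "('m \<Rightarrow> nat \<Rightarrow> 's) \<Rightarrow> ('m \<Rightarrow> nat) \<Rightarrow> 'm \<Rightarrow> 's set" where
  "dataset s N i = s i ` {1..N i}"

definition local_objective ::
    "('m \<Rightarrow> 'a \<Rightarrow> 's \<Rightarrow> real) \<Rightarrow> ('m \<Rightarrow> nat \<Rightarrow> 's) \<Rightarrow> ('m \<Rightarrow> nat) \<Rightarrow> 'm \<Rightarrow> 'a \<Rightarrow> real" where
  "local_objective cost s N i \<theta> = (1 / real (N i)) * (\<Sum>j=1..N i. cost i \<theta> (s i j))"

definition aggregate_objective :: "('m::finite \<Rightarrow> 'a \<Rightarrow> real) \<Rightarrow> 'a \<Rightarrow> real" where
  "aggregate_objective f \<theta> = (1 / real CARD('m)) * (\<Sum>i\<in>UNIV. f i \<theta>)"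

definition neighbors :: "real^'m^'m \<Rightarrow> 'm \<Rightarrow> 'm set" where
  "neighbors W i = {j. W $ i $ j > 0}"

text \<open>
  The state of all agents after \<open>k\<close> iterations, for stepsizes \<open>step\<close> and one realization
  \<open>noise\<close> of the perturbations.
\<close>

primrec iterates ::
    "real^'m^'m \<Rightarrow> ('m::finite \<Rightarrow> 'a::real_inner \<Rightarrow> real) \<Rightarrow> (nat \<Rightarrow> real) \<Rightarrow> (nat \<Rightarrow> 'm \<Rightarrow> 'a) \<Rightarrow>
     ('m \<Rightarrow> 'a) \<Rightarrow> nat \<Rightarrow> 'm \<Rightarrow> 'a" where
  "iterates W f step noise x0 0 = x0"
| "iterates W f step noise x0 (Suc k) = (\<lambda>i. \<Sum>j\<in>neighbors W i.
     W $ i $ j *\<^sub>R (iterates W f step noise x0 k j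
       - step k *\<^sub>R (gradient (f j) (iterates W f step noise x0 k j) + noise k j)))"

end

theory Submission
  imports Defs
begin

text \<open>
  Convergence to a saddle point turns out to be an event of probability zero for all stepsizes that
  satisfy the hypotheses. The reason is that two runs of the algorithm with the same noise separate
  near a strict saddle, so that the noise of a single iteration almost surely misses the few values from
  which the run stays there.

  Fix a saddle point \<open>\<theta>\<close> and let \<open>H\<close> be the Hessian of \<open>F\<close> at \<open>\<theta>\<close>, with least eigenvalue \<open>-\<gamma> < 0\<close> and
  eigenvector \<open>v\<close>. In the difference of two runs with the same noise the noise cancels, and near \<open>\<theta>\<close> the
  difference of the gradients of agent \<open>j\<close> is almost the Hessian of \<open>f j\<close> applied to the difference of
  the states. The weight matrix contracts the disagreement of the agents, so that the mean \<open>y\<close> of the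
  difference follows \<open>y - t (H y + e)\<close> with a relatively small error \<open>e\<close>. For \<open>0 < c < \<gamma>\<close> such that
  \<open>H + c\<close> is invertible, the form \<open>q y = - y \<bullet> (H + c) y\<close> grows at least by the factor \<open>1 + 2 t c\<close> in such a
  step (\<open>expansion_step\<close>). It is positive at \<open>v\<close>, and the stepsizes have an infinite sum: two runs whose
  states differ by a nonzero multiple of \<open>v\<close> at one time cannot both stay in a small ball around \<open>\<theta>\<close> from
  then on (\<open>trajectories_separate\<close>).

  Now vary the noise of one iteration \<open>k\<close> along the line \<open>(s v, \<dots>, s v)\<close>, the other noise being fixed. This
  moves all the states after the iteration along \<open>v\<close>. So each such line contains at most one value of the noise
  for which all agents stay in the ball from iteration \<open>k + 1\<close> on; as the noise of iteration \<open>k\<close> has a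
  density and is independent of the rest, Fubini's theorem makes this event null
  (\<open>leaves_neighborhood_of_unstable_point\<close>). The saddle points may form a continuum, but
  countably many of these balls cover it.

  Finally, square summability of the stepsizes and the finite second moment of the noise imply that the
  noise terms tend to zero almost surely. The agents then reach consensus, so that the convergence of a
  single agent to a saddle point would bring all of them into one of the balls (\<open>agents_reach_consensus\<close>).
\<close>

section \<open>Gradients and strict derivatives\<close>

lemma gradient_eqI:
  fixes f :: "'a::euclidean_space \<Rightarrow> real"
  assumes "GDERIV f x :> D"
  shows "gradient f x = D"
proof -
  have "E = D" if "GDERIV f x :> E" for E
  proof -
    have "(\<lambda>h. inner h E) = (\<lambda>h. inner h D)"
      using that assms unfolding gderiv_def by (rule has_derivative_unique)
    then show ?thesis
      by (simp add: fun_eq_iff vector_eq_ldot)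
  qed
  with assms show ?thesis
    unfolding gradient_def by (intro the_equality)
qed

lemma differentiable_imp_GDERIV_gradient:
  fixes f :: "'a::euclidean_space \<Rightarrow> real"
  assumes "f differentiable at x"
  shows "GDERIV f x :> gradient f x"
proof -
  obtain f' where f': "(f has_derivative f') (at x)"
    using assms by (auto simp: differentiable_def)
  define D where "D = adjoint f' 1"
  have "linear f'" using f' has_derivative_linear by blast
  then have "f' = (\<lambda>h. inner h D)"
    unfolding D_def by (simp add: adjoint_works fun_eq_iff)
  then have "GDERIV f x :> D"
    using f' by (simp add: gderiv_def)
  then show ?thesis using gradient_eqI by metis
qed

lemma GDERIV_scaled_sum:
  assumes "\<And>i. i \<in> I \<Longrightarrow> GDERIV (f i) x :> D i"
  shows "GDERIV (\<lambda>x. c * (\<Sum>i\<in>I. f i x)) x :> c *\<^sub>R (\<Sum>i\<in>I. D i)"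
proof -
  have "((\<lambda>x. c * (\<Sum>i\<in>I. f i x)) has_derivative (\<lambda>h. c * (\<Sum>i\<in>I. inner h (D i)))) (at x)"
    using assms unfolding gderiv_def
    by (intro has_derivative_mult_right has_derivative_sum) auto
  then show ?thesis
    by (simp add: gderiv_def inner_sum_right)
qed

text \<open>
  Strict differentiability linearizes a map uniformly for pairs of points near \<open>x\<close>. This is what is
  needed to compare two trajectories that run close to a saddle point without ever being at it.
\<close>

definition strict_derivative ::
    "('a::real_normed_vector \<Rightarrow> 'b::real_normed_vector) \<Rightarrow> ('a \<Rightarrow> 'b) \<Rightarrow> 'a \<Rightarrow> bool" where
  "strict_derivative g A x \<longleftrightarrow> bounded_linear A \<and>
     (\<forall>e>0. \<exists>r>0. \<forall>u\<in>ball x r. \<forall>v\<in>ball x r. norm (g v - g u - A (v - u)) \<le> e * norm (v - u))"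

lemma strict_derivative_linear: "strict_derivative g A x \<Longrightarrow> bounded_linear A"
  by (simp add: strict_derivative_def)

lemma strict_derivativeE:
  assumes "strict_derivative g A x" "e > 0"
  obtains r where "r > 0"
    "\<And>u v. u \<in> ball x r \<Longrightarrow> v \<in> ball x r \<Longrightarrow> norm (g v - g u - A (v - u)) \<le> e * norm (v - u)"
  using assms unfolding strict_derivative_def by meson

lemma strict_derivative_imp_has_derivative:
  assumes "strict_derivative g A x"
  shows "(g has_derivative A) (at x)"
  unfolding has_derivative_at_alt
proof (intro conjI allI impI)
  show "bounded_linear A" using assms by (rule strict_derivative_linear)
  fix e :: real assume "e > 0"
  obtain r where r: "r > 0"
    "\<And>u v. u \<in> ball x r \<Longrightarrow> v \<in> ball x r \<Longrightarrow> norm (g v - g u - A (v - u)) \<le> e * norm (v - u)"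
    by (rule strict_derivativeE[OF assms \<open>e > 0\<close>]) blast
  show "\<exists>d>0. \<forall>y. norm (y - x) < d \<longrightarrow> norm (g y - g x - A (y - x)) \<le> e * norm (y - x)"
    using r(1) r(2)[of x] by (intro exI[of _ r]) (auto simp: dist_norm norm_minus_commute[of x])
qed

lemma strict_derivative_uniform_radius:
  assumes "finite I" "\<And>i. i \<in> I \<Longrightarrow> strict_derivative (g i) (A i) x" "e > 0"
  obtains r where "r > 0" "\<And>i u v. i \<in> I \<Longrightarrow> u \<in> ball x r \<Longrightarrow> v \<in> ball x r \<Longrightarrow>
       norm (g i v - g i u - A i (v - u)) \<le> e * norm (v - u)"
proof -
  have "\<forall>i\<in>I. \<exists>r>0. \<forall>u\<in>ball x r. \<forall>v\<in>ball x r.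
      norm (g i v - g i u - A i (v - u)) \<le> e * norm (v - u)"
    using assms(2,3) unfolding strict_derivative_def by blast
  then obtain r where r: "\<And>i. i \<in> I \<Longrightarrow> r i > (0::real)"
    "\<And>i u v. i \<in> I \<Longrightarrow> u \<in> ball x (r i) \<Longrightarrow> v \<in> ball x (r i) \<Longrightarrow>
       norm (g i v - g i u - A i (v - u)) \<le> e * norm (v - u)"
    by metis
  define R where "R = Min (insert 1 (r ` I))"
  have R: "R > 0" "\<And>i. i \<in> I \<Longrightarrow> R \<le> r i"
    using assms(1) r(1) by (auto simp: R_def)
  show ?thesis
  proof (rule that[OF R(1)])
    fix i u v assume "i \<in> I" "u \<in> ball x R" "v \<in> ball x R"
    then show "norm (g i v - g i u - A i (v - u)) \<le> e * norm (v - u)"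
      using R(2)[of i] by (intro r(2)) (auto simp: less_le_trans)
  qed
qed

lemma strict_derivative_scaled_sum:
  assumes "finite I" "\<And>i. i \<in> I \<Longrightarrow> strict_derivative (g i) (A i) x"
  shows "strict_derivative (\<lambda>u. c *\<^sub>R (\<Sum>i\<in>I. g i u)) (\<lambda>u. c *\<^sub>R (\<Sum>i\<in>I. A i u)) x"
  unfolding strict_derivative_def
proof (intro conjI allI impI)
  show "bounded_linear (\<lambda>u. c *\<^sub>R (\<Sum>i\<in>I. A i u))"
    using assms strict_derivative_linear
    by (intro bounded_linear_scaleR_right[THEN bounded_linear_compose] bounded_linear_sum) blast
  fix e :: real assume e: "e > 0"
  define K where "K = (\<bar>c\<bar> + 1) * (real (card I) + 1)"
  have K: "K > 0" by (simp add: K_def add_nonneg_pos)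
  define e' where "e' = e / K"
  have e': "e' > 0" using e K by (simp add: e'_def)
  obtain r where r: "r > 0" "\<And>i u v. i \<in> I \<Longrightarrow> u \<in> ball x r \<Longrightarrow> v \<in> ball x r \<Longrightarrow>
       norm (g i v - g i u - A i (v - u)) \<le> e' * norm (v - u)"
    using strict_derivative_uniform_radius[where g = g and A = A and x = x, OF assms e'] by blast
  have "norm (c *\<^sub>R (\<Sum>i\<in>I. g i v) - c *\<^sub>R (\<Sum>i\<in>I. g i u) - c *\<^sub>R (\<Sum>i\<in>I. A i (v - u)))
          \<le> e * norm (v - u)" if uv: "u \<in> ball x r" "v \<in> ball x r" for u v
  proof -
    have "norm (\<Sum>i\<in>I. g i v - g i u - A i (v - u)) \<le> (\<Sum>i\<in>I. e' * norm (v - u))"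
      using uv by (intro sum_norm_le r(2))
    also have "\<dots> \<le> (real (card I) + 1) * (e' * norm (v - u))"
      using e' by (simp add: distrib_right)
    finally have "norm (\<Sum>i\<in>I. g i v - g i u - A i (v - u)) \<le> (real (card I) + 1) * (e' * norm (v - u))" .
    then have "\<bar>c\<bar> * norm (\<Sum>i\<in>I. g i v - g i u - A i (v - u))
        \<le> (\<bar>c\<bar> + 1) * ((real (card I) + 1) * (e' * norm (v - u)))"
      by (intro mult_mono) auto
    also have "\<dots> = K * e' * norm (v - u)"
      by (simp add: K_def)
    also have "\<dots> = e * norm (v - u)"
      using K by (simp add: e'_def)
    finally show ?thesis
      by (simp add: sum_subtractf flip: scaleR_right_diff_distrib)
  qed
  then show "\<exists>r>0. \<forall>u\<in>ball x r. \<forall>v\<in>ball x r.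
     norm (c *\<^sub>R (\<Sum>i\<in>I. g i v) - c *\<^sub>R (\<Sum>i\<in>I. g i u) - c *\<^sub>R (\<Sum>i\<in>I. A i (v - u))) \<le> e * norm (v - u)"
    using r(1) by blast
qed

lemma has_derivative_hessian:
  assumes "twice_differentiable f"
  shows "(gradient f has_derivative (*v) (hessian f x)) (at x)"
  using assms unfolding twice_differentiable_def hessian_def by (simp add: jacobian_works)

lemma strict_derivative_gradient_of_Lipschitz_hessian:
  fixes f :: "real^'d \<Rightarrow> real"
  assumes f: "twice_differentiable f" and "\<rho> > 0"
    and hessian: "\<And>u v. matrix_norm (hessian f u - hessian f v) \<le> \<rho> * norm (u - v)"
  shows "strict_derivative (gradient f) ((*v) (hessian f x)) x"
  unfolding strict_derivative_def
proof (intro conjI allI impI)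
  show "bounded_linear ((*v) (hessian f x))" by simp
  fix e :: real assume "e > 0"
  have "norm (gradient f v - gradient f u - hessian f x *v (v - u)) \<le> e * norm (v - u)"
    if uv: "u \<in> ball x (e / \<rho>)" "v \<in> ball x (e / \<rho>)" for u v
  proof -
    let ?h = "\<lambda>y. gradient f y - hessian f x *v y"
    have "norm (?h v - ?h u) \<le> e * norm (v - u)"
    proof (rule differentiable_bound[where S = "ball x (e / \<rho>)"])
      fix y assume y: "y \<in> ball x (e / \<rho>)"
      have "(?h has_derivative (\<lambda>h. hessian f y *v h - hessian f x *v h)) (at y)"
        by (intro derivative_intros has_derivative_hessian f bounded_linear_imp_has_derivative) simp
      then have "(?h has_derivative (*v) (hessian f y - hessian f x)) (at y)"
        by (rule has_derivative_eq_rhs) (simp add: matrix_vector_mult_diff_rdistrib fun_eq_iff)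
      then show "(?h has_derivative (*v) (hessian f y - hessian f x)) (at y within ball x (e / \<rho>))"
        by (rule has_derivative_at_withinI)
      have "matrix_norm (hessian f y - hessian f x) \<le> \<rho> * norm (y - x)"
        by (rule hessian)
      also have "\<dots> \<le> e"
        using y \<open>\<rho> > 0\<close> by (simp add: dist_norm norm_minus_commute field_simps)
      finally show "onorm ((*v) (hessian f y - hessian f x)) \<le> e"
        by (simp add: matrix_norm_def)
    qed (use uv in auto)
    then show ?thesis
      by (simp add: matrix_vector_mult_diff_distrib algebra_simps)
  qed
  then show "\<exists>r>0. \<forall>u\<in>ball x r. \<forall>v\<in>ball x r.
      norm (gradient f v - gradient f u - hessian f x *v (v - u)) \<le> e * norm (v - u)"
    using \<open>e > 0\<close> \<open>\<rho> > 0\<close> by (intro exI[of _ "e / \<rho>"]) auto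
qed

text \<open>
  The second difference of \<open>f\<close> is symmetric in \<open>h\<close> and \<open>k\<close>, and it is the increment over \<open>[0, 1]\<close> of
  \<open>t \<mapsto> f (x + t h + k) - f (x + t h)\<close>, whose derivative is nearly the constant \<open>A k \<bullet> h\<close>. Comparing the
  two orders of \<open>h\<close> and \<open>k\<close> yields the symmetry of the second derivative.
\<close>

lemma strict_derivative_second_difference:
  fixes f :: "'a::euclidean_space \<Rightarrow> real"
  assumes f: "\<And>x. GDERIV f x :> g x"
    and A: "\<And>u v. u \<in> ball x r \<Longrightarrow> v \<in> ball x r \<Longrightarrow> norm (g v - g u - A (v - u)) \<le> e * norm (v - u)"
    and "bounded_linear A"
    and small: "norm h + norm k < r"
  shows "\<bar>f (x + h + k) - f (x + h) - (f (x + k) - f x) - inner (A k) h\<bar> \<le> e * norm h * norm k"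
proof -
  define p where "p t = f (x + t *\<^sub>R h + k) - f (x + t *\<^sub>R h) - t * inner (A k) h" for t :: real
  have d: "(p has_derivative (\<lambda>s. s * inner (g (x + t *\<^sub>R h + k) - g (x + t *\<^sub>R h) - A k) h)) (at t within S)"
    for t S
  proof -
    have f': "(f has_derivative (\<lambda>h. inner h (g x))) (at x within S)" for x S
      using f has_derivative_at_withinI unfolding gderiv_def by blast
    show ?thesis
      unfolding p_def
      by (rule derivative_eq_intros f'[THEN has_derivative_compose[rotated]] refl | simp)+
         (auto simp: algebra_simps inner_commute)
  qed
  have "norm (p 1 - p 0) \<le> (e * norm h * norm k) * norm (1 - 0 :: real)"
  proof (rule differentiable_bound[where S = "{0..1::real}"])
    fix t :: real assume t: "t \<in> {0..1}"
    show "(p has_derivative (\<lambda>s. s * inner (g (x + t *\<^sub>R h + k) - g (x + t *\<^sub>R h) - A k) h)) (at t within {0..1})"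
      by (rule d)
    have th: "norm (t *\<^sub>R h) \<le> norm h" using t by (simp add: mult_left_le_one_le)
    then have "norm (t *\<^sub>R h) < r"
      using small norm_ge_zero[of k] by linarith
    moreover have "norm (t *\<^sub>R h + k) < r"
      using small th norm_triangle_ineq[of "t *\<^sub>R h" k] by linarith
    ultimately have "norm (g (x + t *\<^sub>R h + k) - g (x + t *\<^sub>R h) - A k) \<le> e * norm k"
      using A[of "x + t *\<^sub>R h" "x + t *\<^sub>R h + k"] by (simp add: dist_norm add.assoc flip: norm_minus_cancel[of "t *\<^sub>R h + k"])
    then have "\<bar>inner (g (x + t *\<^sub>R h + k) - g (x + t *\<^sub>R h) - A k) h\<bar> \<le> e * norm k * norm h"
      by (meson Cauchy_Schwarz_ineq2 mult_right_mono norm_ge_zero order_trans)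
    then have "\<bar>s * inner (g (x + t *\<^sub>R h + k) - g (x + t *\<^sub>R h) - A k) h\<bar>
        \<le> \<bar>s\<bar> * (e * norm k * norm h)" for s
      unfolding abs_mult by (rule mult_left_mono) simp
    then show "onorm (\<lambda>s. s * inner (g (x + t *\<^sub>R h + k) - g (x + t *\<^sub>R h) - A k) h) \<le> e * norm h * norm k"
      by (intro onorm_le) (simp add: mult.commute mult.left_commute)
  qed auto
  then show ?thesis
    by (simp add: p_def algebra_simps)
qed

text \<open>
  The form \<open>A h \<bullet> k - A k \<bullet> h\<close> is homogeneous, so that an estimate for short vectors, with a relative
  error that is as small as desired, makes it vanish.
\<close>

lemma strict_derivative_gradient_symmetric:
  fixes f :: "'a::euclidean_space \<Rightarrow> real"
  assumes f: "\<And>x. GDERIV f x :> g x" and A: "strict_derivative g A x"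
  shows "inner (A h) k = inner h (A k)"
proof -
  have lin: "bounded_linear A" using A by (rule strict_derivative_linear)
  interpret A: bounded_linear A by (rule lin)
  have "\<bar>inner (A h) k - inner (A k) h\<bar> \<le> 0 + e" if "e > 0" for e
  proof -
    define K where "K = 2 * norm h * norm k + 1"
    have K: "K > 0" by (simp add: K_def add_nonneg_pos)
    define e' where "e' = e / K"
    have e': "e' > 0" using that K by (simp add: e'_def)
    obtain r where r: "r > 0"
      "\<And>u v. u \<in> ball x r \<Longrightarrow> v \<in> ball x r \<Longrightarrow> norm (g v - g u - A (v - u)) \<le> e' * norm (v - u)"
      by (rule strict_derivativeE[OF A e']) blast
    define t where "t = r / (norm h + norm k + 1)"
    have t: "t > 0" using r(1) by (simp add: t_def add_nonneg_pos)
    have "t * (norm h + norm k + 1) = r"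
      unfolding t_def by (smt (verit) norm_ge_zero nonzero_eq_divide_eq)
    then have small: "norm (t *\<^sub>R h) + norm (t *\<^sub>R k) < r"
      using t by (simp add: algebra_simps)
    have 1: "\<bar>f (x + t *\<^sub>R h + t *\<^sub>R k) - f (x + t *\<^sub>R h) - (f (x + t *\<^sub>R k) - f x) - inner (A (t *\<^sub>R k)) (t *\<^sub>R h)\<bar>
        \<le> e' * norm (t *\<^sub>R h) * norm (t *\<^sub>R k)"
      by (rule strict_derivative_second_difference[OF f r(2) lin small])
    have 2: "\<bar>f (x + t *\<^sub>R k + t *\<^sub>R h) - f (x + t *\<^sub>R k) - (f (x + t *\<^sub>R h) - f x) - inner (A (t *\<^sub>R h)) (t *\<^sub>R k)\<bar>
        \<le> e' * norm (t *\<^sub>R k) * norm (t *\<^sub>R h)"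
      by (rule strict_derivative_second_difference[OF f r(2) lin]) (use small in auto)
    have "x + t *\<^sub>R k + t *\<^sub>R h = x + t *\<^sub>R h + t *\<^sub>R k" by simp
    with 1 2 have "\<bar>inner (A (t *\<^sub>R h)) (t *\<^sub>R k) - inner (A (t *\<^sub>R k)) (t *\<^sub>R h)\<bar>
        \<le> 2 * (e' * norm (t *\<^sub>R h) * norm (t *\<^sub>R k))"
      by (simp add: mult.commute mult.left_commute)
    also have "inner (A (t *\<^sub>R h)) (t *\<^sub>R k) - inner (A (t *\<^sub>R k)) (t *\<^sub>R h)
        = t\<^sup>2 * (inner (A h) k - inner (A k) h)"
      by (simp add: A.scaleR power2_eq_square algebra_simps)
    also have "2 * (e' * norm (t *\<^sub>R h) * norm (t *\<^sub>R k)) = t\<^sup>2 * (e' * (2 * norm h * norm k))"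
      using t by (simp add: power2_eq_square)
    finally have "t\<^sup>2 * \<bar>inner (A h) k - inner (A k) h\<bar> \<le> t\<^sup>2 * (e' * (2 * norm h * norm k))"
      by (simp only: abs_mult abs_power2)
    then have "\<bar>inner (A h) k - inner (A k) h\<bar> \<le> e' * (2 * norm h * norm k)"
      using t by (simp only: mult_le_cancel_left_pos zero_less_power)
    also have "\<dots> \<le> e' * (2 * norm h * norm k + 1)"
      using e' by simp
    also have "\<dots> = e' * K" by (simp only: K_def)
    also have "\<dots> = e" using K by (simp add: e'_def)
    finally show ?thesis by simp
  qed
  then have "\<bar>inner (A h) k - inner (A k) h\<bar> \<le> 0"
    by (rule field_le_epsilon)
  then show ?thesis by (simp add: inner_commute)
qed

section \<open>The spectrum of a symmetric matrix\<close>

lemma eigenvectors_of_symmetric_orthogonal: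
  fixes A :: "real^'n^'n"
  assumes sym: "\<And>x y. inner (A *v x) y = inner x (A *v y)"
    and "A *v v = c *\<^sub>R v" "A *v w = d *\<^sub>R w" "c \<noteq> d"
  shows "inner v w = 0"
proof -
  have "c * inner v w = d * inner v w"
    using sym[of v w] assms(2,3) by simp
  then show ?thesis using \<open>c \<noteq> d\<close> by simp
qed

lemma finite_eigenvalues_of_symmetric:
  fixes A :: "real^'n^'n"
  assumes sym: "\<And>x y. inner (A *v x) y = inner x (A *v y)"
  shows "finite (eigenvalues A)"
proof -
  have "\<forall>c\<in>eigenvalues A. \<exists>v. v \<noteq> 0 \<and> A *v v = c *\<^sub>R v"
    by (auto simp: eigenvalues_def)
  then obtain e where e: "\<And>c. c \<in> eigenvalues A \<Longrightarrow> e c \<noteq> 0"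
      "\<And>c. c \<in> eigenvalues A \<Longrightarrow> A *v e c = c *\<^sub>R e c"
    by metis
  have orth: "inner (e c) (e d) = 0" if "c \<in> eigenvalues A" "d \<in> eigenvalues A" "c \<noteq> d" for c d
    by (rule eigenvectors_of_symmetric_orthogonal[OF sym e(2)[OF that(1)] e(2)[OF that(2)] that(3)])
  have "inj_on e (eigenvalues A)"
  proof (rule inj_onI, rule ccontr)
    fix c d assume cd: "c \<in> eigenvalues A" "d \<in> eigenvalues A" "e c = e d" "c \<noteq> d"
    then have "inner (e c) (e c) = 0" using orth[of c d] by simp
    then show False using e(1)[OF cd(1)] by simp
  qed
  moreover have "independent (e ` eigenvalues A)"
  proof (rule pairwise_orthogonal_independent)
    show "pairwise orthogonal (e ` eigenvalues A)"
      using orth by (fastforce simp: pairwise_def orthogonal_def)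
    show "0 \<notin> e ` eigenvalues A" using e(1) by force
  qed
  ultimately show ?thesis
    using independent_imp_finite finite_imageD by blast
qed

text \<open>
  A maximizer \<open>v\<close> of the Rayleigh quotient is an eigenvector: with \<open>S\<close> the maximum, the form of \<open>S - A\<close>
  is nonnegative and vanishes at \<open>v\<close>, and if \<open>u = S v - A v\<close> were nonzero, the form would become
  negative at \<open>v + t u\<close> for a small negative \<open>t\<close>.
\<close>

lemma symmetric_has_eigenvalue:
  fixes A :: "real^'n^'n"
  assumes sym: "\<And>x y. inner (A *v x) y = inner x (A *v y)"
  shows "eigenvalues A \<noteq> {}"
proof -
  let ?q = "\<lambda>w. inner w (A *v w)"
  obtain a :: "real^'n" where "norm a = 1"
    using vector_choose_size[of 1] by auto
  moreover have "continuous_on (sphere 0 1) ?q"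
    by (intro continuous_intros linear_continuous_on) simp
  ultimately obtain v where v: "norm v = 1" "\<And>w. norm w = 1 \<Longrightarrow> ?q w \<le> ?q v"
    using continuous_attains_sup[of "sphere 0 1" ?q] by (auto simp: ex_in_conv[symmetric])
  have q_le: "?q w \<le> ?q v * (norm w)\<^sup>2" for w
  proof (cases "w = 0")
    case False
    then have "?q (w /\<^sub>R norm w) \<le> ?q v" by (intro v(2)) simp
    moreover have "?q (w /\<^sub>R norm w) = ?q w / (norm w)\<^sup>2"
      by (simp add: matrix_vector_mult_scaleR power2_eq_square divide_inverse)
    ultimately show ?thesis using False by (simp add: divide_le_eq)
  qed simp
  define u where "u = ?q v *\<^sub>R v - A *v v"
  define b where "b = ?q v * (norm u)\<^sup>2 - ?q u"
  have b: "b \<ge> 0" using q_le[of u] by (simp add: b_def)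
  have expand: "?q v * (norm (v + t *\<^sub>R u))\<^sup>2 - ?q (v + t *\<^sub>R u) = 2 * t * (norm u)\<^sup>2 + t\<^sup>2 * b" for t
  proof -
    have 1: "(norm (v + t *\<^sub>R u))\<^sup>2 = 1 + 2 * t * inner v u + t\<^sup>2 * (norm u)\<^sup>2"
      unfolding power2_norm_eq_inner using v(1)
      by (simp add: inner_add_left inner_add_right inner_commute power2_eq_square norm_eq_1)
    have 2: "?q (v + t *\<^sub>R u) = ?q v + 2 * t * inner u (A *v v) + t\<^sup>2 * ?q u"
      using sym[of v u]
      by (simp add: matrix_vector_right_distrib matrix_vector_mult_scaleR inner_add_left inner_add_right
          inner_commute power2_eq_square algebra_simps)
    have 3: "(norm u)\<^sup>2 = ?q v * inner v u - inner u (A *v v)"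
      unfolding power2_norm_eq_inner
      by (subst (2) u_def) (simp add: inner_diff_right inner_commute)
    show ?thesis unfolding 1 2 b_def 3 by (simp add: algebra_simps)
  qed
  have "u = 0"
  proof (rule ccontr)
    assume "u \<noteq> 0"
    then have n: "(norm u)\<^sup>2 > 0" by simp
    define t where "t = - (norm u)\<^sup>2 / (b + 1)"
    have tb: "t * (b + 1) = - (norm u)\<^sup>2" using b by (simp add: t_def)
    have t: "t < 0" using n b by (simp add: t_def divide_neg_pos)
    have "0 \<le> t * (2 * (norm u)\<^sup>2 + t * b)"
      using q_le[of "v + t *\<^sub>R u"] expand[of t] by (simp add: power2_eq_square algebra_simps)
    then have "2 * (norm u)\<^sup>2 + t * b \<le> 0"
      using t by (simp add: zero_le_mult_iff)
    then show False using tb n t by (simp add: algebra_simps)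
  qed
  then have "A *v v = ?q v *\<^sub>R v" by (simp add: u_def)
  moreover have "v \<noteq> 0" using v(1) by auto
  ultimately show ?thesis unfolding eigenvalues_def by blast
qed

text \<open>
  Let \<open>-\<gamma>\<close> be the least eigenvalue. Only finitely many \<open>c\<close> in \<open>(0, \<gamma>)\<close> have \<open>-c\<close> as an eigenvalue; for
  every other one \<open>A + c\<close> is invertible and still has a direction of negative curvature. Working
  with the form of \<open>A + c\<close> takes the place of a spectral splitting into expanding and other directions,
  and copes with a degenerate \<open>A\<close>.
\<close>

lemma unstable_direction_of_symmetric:
  fixes A :: "real^'n^'n"
  assumes sym: "\<And>x y. inner (A *v x) y = inner x (A *v y)"
    and neg: "Min (eigenvalues A) < 0"
  obtains v c \<kappa> where "c > 0" "\<kappa> > 0" "inner v (A *v v + c *\<^sub>R v) < 0"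
    "\<forall>y. \<kappa> * norm y \<le> norm (A *v y + c *\<^sub>R y)"
proof -
  note fin = finite_eigenvalues_of_symmetric[OF sym]
  define \<gamma> where "\<gamma> = - Min (eigenvalues A)"
  have "- \<gamma> \<in> eigenvalues A"
    using Min_in[OF fin symmetric_has_eigenvalue[OF sym]] by (simp add: \<gamma>_def)
  then obtain v where v: "v \<noteq> 0" "A *v v = - \<gamma> *\<^sub>R v"
    by (auto simp: eigenvalues_def)
  have "infinite {0<..<\<gamma>}" using neg by (simp add: \<gamma>_def infinite_Ioo)
  then have "{0<..<\<gamma>} - uminus ` eigenvalues A \<noteq> {}"
    using fin by (metis finite_imageI finite.emptyI Diff_infinite_finite)
  then obtain c where c: "0 < c" "c < \<gamma>" "- c \<notin> eigenvalues A"
    by (force simp: image_iff)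
  have lin: "linear (\<lambda>y. A *v y + c *\<^sub>R y)"
    by (intro linear_compose_add matrix_vector_mul_linear linear_compose_scale_right linear_ident)
  moreover have "inj (\<lambda>y. A *v y + c *\<^sub>R y)"
    unfolding linear_injective_0[OF lin]
  proof (intro allI impI)
    fix y assume "A *v y + c *\<^sub>R y = 0"
    then have "A *v y = (- c) *\<^sub>R y" by (simp add: eq_neg_iff_add_eq_0)
    then show "y = 0" using c(3) by (auto simp: eigenvalues_def)
  qed
  ultimately obtain \<kappa> where \<kappa>: "\<kappa> > 0" "\<And>y. \<kappa> * norm y \<le> norm (A *v y + c *\<^sub>R y)"
    using linear_inj_bounded_below_pos by blast
  have "inner v (A *v v + c *\<^sub>R v) = (c - \<gamma>) * inner v v"
    by (simp add: v(2) inner_add_right algebra_simps)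
  also have "\<dots> < 0" using c v(1) by (simp add: mult_neg_pos)
  finally show ?thesis using that c(1) \<kappa> by blast
qed

section \<open>Mixing, mean and disagreement\<close>

definition mix :: "real^'m^'m \<Rightarrow> 'a::real_vector^'m \<Rightarrow> 'a^'m" where
  "mix A D = (\<chi> i. \<Sum>j\<in>UNIV. A $ i $ j *\<^sub>R D $ j)"

definition mean :: "'a::real_vector^'m \<Rightarrow> 'a" where
  "mean D = (1 / real CARD('m)) *\<^sub>R (\<Sum>j\<in>UNIV. D $ j)"

definition disagreement :: "'a::real_vector^'m \<Rightarrow> 'a^'m" where
  "disagreement D = D - vec (mean D)"

lemma mix_diff: "mix A (D - E) = mix A D - mix A E"
  by (simp add: mix_def vec_eq_iff scaleR_right_diff_distrib sum_subtractf)

lemma mix_diff_left: "mix (A - B) D = mix A D - mix B D"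
  by (simp add: mix_def vec_eq_iff scaleR_left_diff_distrib sum_subtractf)

lemma mean_diff: "mean (D - E) = mean D - mean E"
  by (simp add: mean_def scaleR_right_diff_distrib sum_subtractf)

lemma mean_add: "mean (D + E) = mean D + mean E"
  by (simp add: mean_def scaleR_right_distrib sum.distrib)

lemma mean_scaleR: "mean (c *\<^sub>R D) = c *\<^sub>R mean D"
  by (simp add: mean_def mult.commute flip: scaleR_sum_right)

lemma mean_vec [simp]: "mean (vec p) = p"
  by (simp add: mean_def sum_constant_scaleR del: sum_constant)

lemma mix_averaging: "mix (\<chi> i j. 1 / real CARD('m)) (D :: 'a::real_vector^'m) = vec (mean D)"
  by (simp add: mix_def mean_def vec_eq_iff scaleR_sum_right)

lemma mix_vec:
  assumes "W *v 1 = 1"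
  shows "mix W (vec p) = vec p"
proof -
  have "(\<Sum>j\<in>UNIV. W $ i $ j) = 1" for i
    using arg_cong[OF assms, of "\<lambda>v. v $ i"] by (simp add: matrix_vector_mult_def)
  then show ?thesis
    by (simp add: mix_def vec_eq_iff flip: scaleR_sum_left)
qed

lemma mean_mix:
  assumes "1 v* W = 1"
  shows "mean (mix W D) = mean D"
proof -
  have "(\<Sum>i\<in>UNIV. W $ i $ j) = 1" for j
    using arg_cong[OF assms, of "\<lambda>v. v $ j"] by (simp add: vector_matrix_mult_def)
  then have "(\<Sum>i\<in>UNIV. \<Sum>j\<in>UNIV. W $ i $ j *\<^sub>R D $ j) = (\<Sum>j\<in>UNIV. D $ j)"
    by (subst sum.swap) (simp flip: scaleR_sum_left)
  then show ?thesis
    by (simp add: mix_def mean_def)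
qed

lemma power2_norm_vec: "(norm (x :: 'a::real_normed_vector^'m))\<^sup>2 = (\<Sum>i\<in>UNIV. (norm (x $ i))\<^sup>2)"
  by (simp add: norm_vec_def L2_set_def sum_nonneg)

text \<open>
  \<open>mix A\<close> applies the matrix \<open>A\<close> to each coordinate of the agents' states separately, so that the
  operator norm of \<open>A\<close> also bounds \<open>mix A\<close>.
\<close>

lemma norm_mix_le:
  fixes D :: "'a::euclidean_space^'m"
  shows "norm (mix A D) \<le> matrix_norm A * norm D"
proof -
  have nonneg: "0 \<le> matrix_norm A"
    unfolding matrix_norm_def by (rule onorm_pos_le) simp
  have parseval: "(norm x)\<^sup>2 = (\<Sum>b\<in>Basis. (inner x b)\<^sup>2)" for x :: 'a
    by (subst power2_norm_eq_inner, subst euclidean_inner) (simp add: power2_eq_square)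
  define u where "u b = (\<chi> j. inner (D $ j) b)" for b
  have coord: "inner (mix A D $ i) b = (A *v u b) $ i" for i b
    by (simp add: mix_def u_def matrix_vector_mult_def inner_sum_left)
  have "(norm (mix A D))\<^sup>2 = (\<Sum>b\<in>Basis. (norm (A *v u b))\<^sup>2)"
    unfolding power2_norm_vec parseval coord by (subst sum.swap) simp
  also have "\<dots> \<le> (\<Sum>b\<in>Basis. (matrix_norm A * norm (u b))\<^sup>2)"
    unfolding matrix_norm_def by (intro sum_mono power_mono onorm) auto
  also have "\<dots> = (matrix_norm A)\<^sup>2 * (\<Sum>b\<in>Basis. (norm (u b))\<^sup>2)"
    by (simp add: power_mult_distrib sum_distrib_left)
  also have "(\<Sum>b\<in>Basis. (norm (u b))\<^sup>2) = (norm D)\<^sup>2"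
    unfolding power2_norm_vec parseval u_def by (subst sum.swap) simp
  finally have "(norm (mix A D))\<^sup>2 \<le> (matrix_norm A * norm D)\<^sup>2"
    by (simp add: power_mult_distrib)
  then show ?thesis
    by (rule power2_le_imp_le) (simp add: nonneg)
qed

lemma norm_mean_le: "norm (mean D) \<le> norm (D :: 'a::real_normed_vector^'m)"
proof -
  have "norm (\<Sum>j\<in>UNIV. D $ j) \<le> (\<Sum>j\<in>(UNIV :: 'm set). norm D)"
    by (intro sum_norm_le Finite_Cartesian_Product.norm_nth_le)
  then show ?thesis
    by (simp add: mean_def divide_le_eq mult.commute)
qed

lemma norm_vec_le: "norm (vec p :: 'a::real_normed_vector^'m) \<le> real CARD('m) * norm p"
  using L2_set_le_sum[of UNIV "\<lambda>i. norm ((vec p :: 'a^'m) $ i)"] by (simp add: norm_vec_def)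

lemma norm_le_componentwise:
  fixes U D :: "'a::real_normed_vector^'m"
  assumes "\<And>j. norm (U $ j) \<le> L * norm (D $ j)" "L \<ge> 0"
  shows "norm U \<le> L * norm D"
proof -
  have "norm U \<le> L2_set (\<lambda>j. L * norm (D $ j)) UNIV"
    unfolding norm_vec_def by (intro L2_set_mono assms) auto
  also have "\<dots> = L * norm D"
    using assms(2) by (simp add: norm_vec_def L2_set_right_distrib)
  finally show ?thesis .
qed

text \<open>
  The mean is preserved by \<open>mix W\<close>, so the disagreement after mixing is the image under
  \<open>W - J\<close>, where \<open>J\<close> is the averaging matrix; and \<open>W - J\<close> annihilates consensus vectors.
\<close>

lemma disagreement_mix_le:
  fixes D U :: "'a::euclidean_space^'m"
  assumes rows: "W *v 1 = 1" and columns: "1 v* W = 1"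
    and \<eta>: "matrix_norm (W - (\<chi> i j. 1 / real CARD('m))) = \<eta>"
  shows "norm (disagreement (mix W (D - U))) \<le> \<eta> * (norm (disagreement D) + norm U)"
proof -
  let ?J = "(\<chi> i j. 1 / real CARD('m)) :: real^'m^'m"
  have "disagreement (mix W (D - U)) = mix (W - ?J) (D - U)"
    by (simp add: disagreement_def mean_mix columns mix_diff_left mix_averaging)
  also have "\<dots> = mix (W - ?J) (disagreement D - U)"
    by (simp add: disagreement_def mix_diff mix_diff_left mix_averaging mix_vec[OF rows] mean_diff)
  finally have "norm (disagreement (mix W (D - U))) \<le> \<eta> * norm (disagreement D - U)"
    using norm_mix_le[of "W - ?J" "disagreement D - U"] \<eta> by simp
  also have "\<dots> \<le> \<eta> * (norm (disagreement D) + norm U)"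
  proof (rule mult_left_mono[OF norm_triangle_ineq4])
    show "0 \<le> \<eta>" unfolding \<eta>[symmetric] matrix_norm_def by (rule onorm_pos_le) simp
  qed
  finally show ?thesis .
qed

section \<open>Expansion of differences near an unstable point\<close>

text \<open>
  \<open>A j\<close> stands for the Hessian of agent \<open>j\<close> at a saddle point, and \<open>H\<close> for the Hessian of the aggregated
  objective. The instability is a property of the mean \<open>H\<close> alone, and it governs the network because
  mixing keeps the agents together.
\<close>

locale unstable_linearization =
  fixes W :: "real^'m^'m" and A :: "'m \<Rightarrow> 'a \<Rightarrow> 'a::euclidean_space" and H :: "'a \<Rightarrow> 'a"
    and \<eta> c \<kappa> b L :: real
  assumes rows: "W *v 1 = 1" and columns: "1 v* W = 1"
    and contraction: "matrix_norm (W - (\<chi> i j. 1 / real CARD('m))) = \<eta>" "\<eta> < 1"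
    and linear: "\<And>j. linear (A j)"
    and A_le: "\<And>j y. norm (A j y) \<le> L * norm y"
    and H: "\<And>y. H y = mean (\<chi> j. A j y)"
    and sym: "\<And>x y. inner (H x) y = inner x (H y)"
    and c: "c > 0" and \<kappa>: "\<kappa> > 0" and b: "b > 0" and L: "L > 0"
    and below: "\<And>y. \<kappa> * norm y \<le> norm (H y + c *\<^sub>R y)"
    and above: "\<And>y. norm (H y + c *\<^sub>R y) \<le> b * norm y"
begin

text \<open>
  The form \<open>q\<close> is a Lyapunov function for the difference of two trajectories: as long as the
  disagreement and the linearization error are relatively small, it grows by a factor of at least
  \<open>1 + 2 t c\<close> in each step of size \<open>t\<close>. The constants below fix, in this order, a bound for
  the norm of a difference relative to its mean, the tolerated linearization error, the opening of the
  cone of differences whose disagreement is small relative to their mean, and the largest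
  admissible stepsize.
\<close>

definition q :: "'a \<Rightarrow> real" where
  "q y = - inner y (H y + c *\<^sub>R y)"

definition M :: real where
  "M = real CARD('m) + 1"

definition \<epsilon> :: real where
  "\<epsilon> = min L (\<kappa>\<^sup>2 / (4 * b * M))"

definition \<tau> :: real where
  "\<tau> = min 1 (\<kappa>\<^sup>2 / (4 * b * L))"

definition \<Lambda> :: real where
  "\<Lambda> = min (\<tau> * (1 - \<eta>) / (4 * L * M)) (\<kappa>\<^sup>2 / (4 * b * L\<^sup>2 * M\<^sup>2))"

lemma M_pos: "M > 0"
  by (simp add: M_def)

lemma \<epsilon>_pos: "\<epsilon> > 0" and \<tau>_pos: "\<tau> > 0" and \<Lambda>_pos: "\<Lambda> > 0"
proof -
  show "\<epsilon> > 0" using \<kappa> b L M_pos by (simp add: \<epsilon>_def)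
  show \<tau>: "\<tau> > 0" using \<kappa> b L by (simp add: \<tau>_def)
  show "\<Lambda> > 0" using \<kappa> b L \<tau> M_pos contraction(2) by (simp add: \<Lambda>_def)
qed

lemma H_linear: "linear H"
proof -
  have "H = (\<lambda>y. (1 / real CARD('m)) *\<^sub>R (\<Sum>j\<in>UNIV. A j y))"
    by (simp add: fun_eq_iff H mean_def)
  then show ?thesis
    using linear by (simp add: linear_compose_scale_right linear_compose_sum)
qed

text \<open>
  With \<open>B = H + c\<close> and \<open>H y = B y - c y\<close>, the first-order change of \<open>q\<close> along \<open>- H y\<close> is
  \<open>2 t (norm (B y)\<^sup>2 + c q y)\<close>. Since \<open>B\<close> is bounded below, the first term absorbs
  the errors, no matter in which direction \<open>y\<close> points.
\<close>

lemma q_step: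
  "q (y - t *\<^sub>R (H y + e)) = q y + 2 * t * ((norm (H y + c *\<^sub>R y))\<^sup>2 + c * q y + inner e (H y + c *\<^sub>R y))
     - t\<^sup>2 * inner (H y + e) (H (H y + e) + c *\<^sub>R (H y + e))"
proof -
  define w where "w = H y + e"
  have Hd: "H (y - t *\<^sub>R w) = H y - t *\<^sub>R H w"
    using H_linear by (simp add: linear_diff linear_scale)
  have 1: "q (y - t *\<^sub>R w) = q y + 2 * t * inner w (H y + c *\<^sub>R y) - t\<^sup>2 * inner w (H w + c *\<^sub>R w)"
    using sym[of y w] unfolding q_def Hd
    by (simp add: inner_add_left inner_add_right inner_diff_left inner_diff_right inner_commute
        power2_eq_square algebra_simps)
  have "w = (H y + c *\<^sub>R y) - c *\<^sub>R y + e" by (simp add: w_def)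
  then have "inner w (H y + c *\<^sub>R y)
      = inner ((H y + c *\<^sub>R y) - c *\<^sub>R y + e) (H y + c *\<^sub>R y)" by simp
  also have "\<dots> = (norm (H y + c *\<^sub>R y))\<^sup>2 + c * q y + inner e (H y + c *\<^sub>R y)"
    unfolding power2_norm_eq_inner q_def inner_add_left[of _ e] inner_diff_left by simp
  finally show ?thesis
    using 1 by (simp add: w_def)
qed

text \<open>
  The cone of small disagreement is invariant because the disagreement contracts by the factor
  \<open>\<eta> < 1\<close> in each step, whereas the mean changes by \<open>O(t)\<close>. Inside the cone the difference behaves like
  its mean up to an error that is a small multiple of the mean, and then \<open>q_step\<close> applies.
\<close>

lemma expansion_step:
  fixes D U :: "'a^'m"
  assumes U: "\<And>j. norm (U $ j - A j (D $ j)) \<le> \<epsilon> * norm (D $ j)"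
    and cone: "norm (disagreement D) \<le> \<tau> * norm (mean D)"
    and t: "0 < t" "t \<le> \<Lambda>"
  defines "D' \<equiv> mix W (D - t *\<^sub>R U)"
  shows "norm (disagreement D') \<le> \<tau> * norm (mean D')"
    and "(1 + 2 * t * c) * q (mean D) \<le> q (mean D')"
proof -
  let ?y = "mean D"
  define p where "p = norm ?y"
  have p: "p \<ge> 0" by (simp add: p_def)
  define w where "w = mean U"
  define e where "e = w - H ?y"
  have \<eta>: "0 \<le> \<eta>" unfolding contraction(1)[symmetric] matrix_norm_def by (rule onorm_pos_le) simp
  note pos = M_pos \<epsilon>_pos \<tau>_pos \<Lambda>_pos L b \<kappa> c

  have "norm D \<le> norm (disagreement D) + norm (vec ?y :: 'a^'m)"
    using norm_triangle_ineq[of "disagreement D" "vec ?y"] by (simp add: disagreement_def)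
  also have "\<dots> \<le> \<tau> * p + real CARD('m) * p"
    using cone norm_vec_le[of ?y] unfolding p_def by (intro add_mono) auto
  also have "\<dots> \<le> M * p"
    using p by (simp add: M_def \<tau>_def algebra_simps mult_left_le)
  finally have D_le: "norm D \<le> M * p" .

  have "norm (U $ j) \<le> (2 * L) * norm (D $ j)" for j
  proof -
    have "norm (U $ j) \<le> norm (U $ j - A j (D $ j)) + norm (A j (D $ j))"
      by (metis diff_add_cancel norm_triangle_ineq)
    also have "\<dots> \<le> \<epsilon> * norm (D $ j) + L * norm (D $ j)"
      using U A_le by (intro add_mono) auto
    also have "\<dots> \<le> L * norm (D $ j) + L * norm (D $ j)"
      by (intro add_mono mult_right_mono) (auto simp: \<epsilon>_def)
    finally show ?thesis by simp
  qed
  then have "norm U \<le> (2 * L) * norm D"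
    using pos by (intro norm_le_componentwise) auto
  also have "\<dots> \<le> (2 * L) * (M * p)"
    using D_le pos by (intro mult_left_mono) auto
  finally have U_le: "norm U \<le> 2 * L * M * p" by simp
  have w_le: "norm w \<le> 2 * L * M * p"
    using norm_mean_le[of U] U_le by (simp add: w_def)

  have "e = mean (U - (\<chi> j. A j ?y))"
    by (simp add: e_def w_def H mean_diff)
  also have "U - (\<chi> j. A j ?y) = (\<chi> j. U $ j - A j (D $ j)) + (\<chi> j. A j (disagreement D $ j))"
    using linear by (simp add: vec_eq_iff disagreement_def linear_diff)
  also have "mean \<dots> = mean (\<chi> j. U $ j - A j (D $ j)) + mean (\<chi> j. A j (disagreement D $ j))"
    by (rule mean_add)
  finally have e_eq: "e = mean (\<chi> j. U $ j - A j (D $ j)) + mean (\<chi> j. A j (disagreement D $ j))" .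
  have "norm e \<le> norm (mean (\<chi> j. U $ j - A j (D $ j))) + norm (mean (\<chi> j. A j (disagreement D $ j)))"
    unfolding e_eq by (rule norm_triangle_ineq)
  also have "\<dots> \<le> norm (\<chi> j. U $ j - A j (D $ j)) + norm (\<chi> j. A j (disagreement D $ j))"
    by (intro add_mono norm_mean_le)
  also have "\<dots> \<le> \<epsilon> * norm D + L * norm (disagreement D)"
    using U A_le pos by (intro add_mono norm_le_componentwise) auto
  also have "\<dots> \<le> \<epsilon> * (M * p) + L * (\<tau> * p)"
    using D_le cone pos unfolding p_def by (intro add_mono mult_left_mono) auto
  also have "\<dots> = (\<epsilon> * M + L * \<tau>) * p"
    by (simp add: algebra_simps)
  also have "\<dots> \<le> (\<kappa>\<^sup>2 / (2 * b)) * p"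
  proof (rule mult_right_mono[OF _ p])
    have "\<epsilon> * M \<le> \<kappa>\<^sup>2 / (4 * b * M) * M"
      using pos by (intro mult_right_mono) (auto simp: \<epsilon>_def)
    also have "\<dots> = \<kappa>\<^sup>2 / (4 * b)"
      using pos by simp
    finally have 1: "\<epsilon> * M \<le> \<kappa>\<^sup>2 / (4 * b)" .
    have "L * \<tau> \<le> L * (\<kappa>\<^sup>2 / (4 * b * L))"
      using pos by (intro mult_left_mono) (auto simp: \<tau>_def)
    also have "\<dots> = \<kappa>\<^sup>2 / (4 * b)"
      using pos by simp
    finally show "\<epsilon> * M + L * \<tau> \<le> \<kappa>\<^sup>2 / (2 * b)" using 1 by simp
  qed
  finally have e_le: "norm e \<le> (\<kappa>\<^sup>2 / (2 * b)) * p" .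

  have mean': "mean D' = ?y - t *\<^sub>R w"
    by (simp add: D'_def mean_mix columns mean_diff mean_scaleR w_def)

  have tLM: "t * (2 * L * M) \<le> \<tau> * (1 - \<eta>) / 2"
  proof -
    have "t * (2 * L * M) \<le> (\<tau> * (1 - \<eta>) / (4 * L * M)) * (2 * L * M)"
      using t pos by (intro mult_right_mono) (auto simp: \<Lambda>_def)
    also have "\<dots> = \<tau> * (1 - \<eta>) / 2"
      using pos by (simp add: field_simps)
    finally show ?thesis .
  qed
  show "norm (disagreement D') \<le> \<tau> * norm (mean D')"
  proof -
    define s where "s = t * (2 * L * M)"
    have s: "0 \<le> s" "s \<le> \<tau> * (1 - \<eta>) / 2"
      using tLM t pos by (auto simp: s_def)
    have "norm (disagreement D') \<le> \<eta> * (norm (disagreement D) + norm (t *\<^sub>R U))"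
      unfolding D'_def by (rule disagreement_mix_le[OF rows columns contraction(1)])
    also have "\<dots> \<le> \<eta> * (\<tau> * p + s * p)"
    proof (intro mult_left_mono add_mono \<eta>)
      show "norm (disagreement D) \<le> \<tau> * p" using cone by (simp add: p_def)
      show "norm (t *\<^sub>R U) \<le> s * p"
        using mult_left_mono[OF U_le, of t] t by (simp add: s_def mult.assoc)
    qed
    also have "\<dots> = (\<eta> * \<tau> + \<eta> * s) * p" by (simp add: algebra_simps)
    also have "\<dots> \<le> (\<tau> * (1 - s)) * p"
    proof (rule mult_right_mono[OF _ p])
      have "\<eta> * s \<le> s" using s \<eta> contraction(2) by (simp add: mult_left_le_one_le)
      moreover have "\<tau> * s \<le> s" using s pos by (intro mult_left_le_one_le) (auto simp: \<tau>_def)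
      ultimately show "\<eta> * \<tau> + \<eta> * s \<le> \<tau> * (1 - s)" using s by (simp add: algebra_simps)
    qed
    also have "\<dots> = \<tau> * (p - s * p)" by (simp add: algebra_simps)
    also have "\<dots> \<le> \<tau> * norm (mean D')"
    proof (rule mult_left_mono)
      have "norm ?y - norm (t *\<^sub>R w) \<le> norm (?y - t *\<^sub>R w)" by (rule norm_triangle_ineq2)
      moreover have "norm (t *\<^sub>R w) \<le> s * p"
        using mult_left_mono[OF w_le, of t] t by (simp add: s_def mult.assoc)
      ultimately show "p - s * p \<le> norm (mean D')" unfolding mean' p_def by simp
    qed (use pos in simp)
    finally show ?thesis .
  qed

  \<comment> \<open>Half of the gain \<open>2 t \<kappa>\<^sup>2 p\<^sup>2\<close> pays for the linearization error, the other half for the term of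
     second order in \<open>t\<close>.\<close>
  let ?By = "H ?y + c *\<^sub>R ?y"
  have w_eq: "w = H ?y + e" by (simp add: e_def)
  have 1: "q (mean D') = q ?y + 2 * t * ((norm ?By)\<^sup>2 + c * q ?y + inner e ?By)
     - t\<^sup>2 * inner w (H w + c *\<^sub>R w)"
    unfolding mean' w_eq by (rule q_step)
  have 2: "\<kappa>\<^sup>2 * p\<^sup>2 \<le> (norm ?By)\<^sup>2"
    using power_mono[OF below[of ?y], of 2] pos by (simp add: p_def power_mult_distrib)
  have "\<bar>inner e ?By\<bar> \<le> norm e * norm ?By" by (rule Cauchy_Schwarz_ineq2)
  also have "\<dots> \<le> ((\<kappa>\<^sup>2 / (2 * b)) * p) * (b * p)"
    using e_le above[of ?y] pos p unfolding p_def by (intro mult_mono) auto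
  also have "\<dots> = \<kappa>\<^sup>2 * p\<^sup>2 / 2" using pos by (simp add: power2_eq_square)
  finally have 3: "- (\<kappa>\<^sup>2 * p\<^sup>2 / 2) \<le> inner e ?By" by linarith
  have "inner w (H w + c *\<^sub>R w) \<le> norm w * norm (H w + c *\<^sub>R w)" by (rule norm_cauchy_schwarz)
  also have "\<dots> \<le> norm w * (b * norm w)" by (intro mult_left_mono above) simp
  also have "\<dots> = b * (norm w)\<^sup>2" by (simp add: power2_eq_square)
  also have "\<dots> \<le> b * (2 * L * M * p)\<^sup>2"
    using w_le pos by (intro mult_left_mono power_mono) auto
  finally have "t * inner w (H w + c *\<^sub>R w) \<le> t * (b * (2 * L * M * p)\<^sup>2)"
    using t by (intro mult_left_mono) auto
  also have "\<dots> = t * (4 * b * L\<^sup>2 * M\<^sup>2) * p\<^sup>2" by (simp add: power2_eq_square)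
  also have "\<dots> \<le> \<kappa>\<^sup>2 * p\<^sup>2"
  proof (rule mult_right_mono)
    have "t * (4 * b * L\<^sup>2 * M\<^sup>2) \<le> (\<kappa>\<^sup>2 / (4 * b * L\<^sup>2 * M\<^sup>2)) * (4 * b * L\<^sup>2 * M\<^sup>2)"
      using t pos by (intro mult_right_mono) (auto simp: \<Lambda>_def)
    also have "\<dots> = \<kappa>\<^sup>2" using pos by simp
    finally show "t * (4 * b * L\<^sup>2 * M\<^sup>2) \<le> \<kappa>\<^sup>2" .
  qed simp
  finally have 4: "t * inner w (H w + c *\<^sub>R w) \<le> \<kappa>\<^sup>2 * p\<^sup>2" .
  have "(1 + 2 * t * c) * q ?y = q ?y + t * (2 * (c * q ?y))" by (simp add: algebra_simps)
  also have "\<dots> \<le> q ?y + t * (2 * ((norm ?By)\<^sup>2 + c * q ?y + inner e ?By)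
     - t * inner w (H w + c *\<^sub>R w))"
    using 2 3 4 t by (intro add_left_mono mult_left_mono) auto
  also have "\<dots> = q (mean D')" unfolding 1 by (simp add: algebra_simps power2_eq_square)
  finally show "(1 + 2 * t * c) * q ?y \<le> q (mean D')" .
qed

end

definition noisy_descent ::
    "real^'m^'m \<Rightarrow> ('m \<Rightarrow> 'a \<Rightarrow> 'a) \<Rightarrow> (nat \<Rightarrow> real) \<Rightarrow> (nat \<Rightarrow> 'm \<Rightarrow> 'a) \<Rightarrow> (nat \<Rightarrow> 'm \<Rightarrow> 'a::real_vector) \<Rightarrow> bool" where
  "noisy_descent W g t noise x \<longleftrightarrow> (\<forall>n i. x (Suc n) i =
     (\<Sum>j\<in>UNIV. W $ i $ j *\<^sub>R (x n j - t n *\<^sub>R (g j (x n j) + noise n j))))"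

context unstable_linearization
begin

lemma q_scale: "q (s *\<^sub>R y) = s\<^sup>2 * q y"
  using H_linear by (simp add: q_def linear_scale power2_eq_square algebra_simps inner_add_right)

lemma q_le: "q y \<le> b * (norm y)\<^sup>2"
proof -
  have "q y \<le> norm y * norm (H y + c *\<^sub>R y)"
    unfolding q_def using Cauchy_Schwarz_ineq2[of y "H y + c *\<^sub>R y"] by linarith
  also have "\<dots> \<le> norm y * (b * norm y)"
    by (intro mult_left_mono above) simp
  finally show ?thesis by (simp add: power2_eq_square algebra_simps)
qed

text \<open>
  The growth factors of \<open>q\<close> multiply to at least \<open>1 + 2 c \<Sum>t\<close>, which diverges, while \<open>q\<close> is bounded on
  bounded sets.
\<close>

lemma differences_unbounded:
  fixes D U :: "nat \<Rightarrow> 'a^'m" and t :: "nat \<Rightarrow> real"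
  assumes step: "\<And>n. D (Suc n) = mix W (D n - t n *\<^sub>R U n)"
    and U: "\<And>n j. norm (U n $ j - A j (D n $ j)) \<le> \<epsilon> * norm (D n $ j)"
    and init: "disagreement (D 0) = 0" "q (mean (D 0)) > 0"
    and t: "\<And>n. 0 < t n" "\<And>n. t n \<le> \<Lambda>" "\<not> summable t"
  shows "\<not> (\<forall>n. norm (mean (D n)) \<le> R)"
proof
  assume bounded: "\<forall>n. norm (mean (D n)) \<le> R"
  define q0 where "q0 = q (mean (D 0))"
  have q0: "q0 > 0" using init(2) by (simp add: q0_def)
  have inv: "norm (disagreement (D n)) \<le> \<tau> * norm (mean (D n)) \<and>
      q0 * (1 + 2 * c * (\<Sum>i<n. t i)) \<le> q (mean (D n))" for n
  proof (induction n)
    case 0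
    show ?case using init \<tau>_pos by (simp add: q0_def)
  next
    case (Suc n)
    have cone: "norm (disagreement (D n)) \<le> \<tau> * norm (mean (D n))" using Suc by blast
    note expand = expansion_step[OF U cone t(1,2)[of n], folded step]
    have "0 \<le> (\<Sum>i<n. t i)" using t(1) by (intro sum_nonneg) (simp add: less_imp_le)
    then have "q0 * 1 \<le> q0 * (1 + 2 * c * (\<Sum>i<n. t i))"
      using q0 c by (intro mult_left_mono) auto
    then have "q0 \<le> q (mean (D n))" using Suc by linarith
    then have "2 * t n * c * q0 \<le> 2 * t n * c * q (mean (D n))"
      using t(1)[of n] c by (intro mult_left_mono) auto
    moreover have "q0 * (1 + 2 * c * (\<Sum>i<Suc n. t i))
        = q0 * (1 + 2 * c * (\<Sum>i<n. t i)) + 2 * t n * c * q0"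
      by (simp add: algebra_simps)
    moreover have "(1 + 2 * t n * c) * q (mean (D n)) = q (mean (D n)) + 2 * t n * c * q (mean (D n))"
      by (simp add: algebra_simps)
    ultimately show ?case using Suc expand by (intro conjI) linarith+
  qed
  have "(\<Sum>i<n. t i) \<le> b * R\<^sup>2 / (2 * c * q0)" for n
  proof -
    have "q0 * (1 + 2 * c * (\<Sum>i<n. t i)) \<le> b * (norm (mean (D n)))\<^sup>2"
      using inv[of n] q_le[of "mean (D n)"] by linarith
    also have "\<dots> \<le> b * R\<^sup>2"
      using bounded b by (intro mult_left_mono power_mono) auto
    finally have "(\<Sum>i<n. t i) * (2 * c * q0) \<le> b * R\<^sup>2"
      using q0 by (simp add: algebra_simps)
    then show ?thesis using c q0 by (simp add: pos_le_divide_eq)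
  qed
  then have "summable t"
    using t(1) by (intro summableI_nonneg_bounded) (auto intro: less_imp_le)
  with t(3) show False by blast
qed

text \<open>
  Two runs under the same noise, started at distinct points on a line in the direction \<open>v\<close> (the same
  displacement for all agents, hence without disagreement), cannot both stay near \<open>\<theta>\<close> forever: the
  noise cancels in their difference, which is then expanded without bound.
\<close>

lemma trajectories_separate:
  fixes g :: "'m \<Rightarrow> 'a \<Rightarrow> 'a"
  assumes strict: "\<And>j. strict_derivative (g j) (A j) \<theta>" and v: "q v > 0"
  shows "\<exists>r>0. \<forall>x x' noise t s.
      noisy_descent W g t noise x \<and> noisy_descent W g t noise x' \<and>
      (\<forall>j. x' 0 j = x 0 j + s *\<^sub>R v) \<and> (\<forall>n. 0 < t n \<and> t n \<le> \<Lambda>) \<and> \<not> summable t \<and>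
      (\<forall>n j. x n j \<in> ball \<theta> r \<and> x' n j \<in> ball \<theta> r) \<longrightarrow> s = 0"
proof -
  obtain r where r: "r > 0" "\<And>j u v. u \<in> ball \<theta> r \<Longrightarrow> v \<in> ball \<theta> r \<Longrightarrow>
      norm (g j v - g j u - A j (v - u)) \<le> \<epsilon> * norm (v - u)"
    using strict_derivative_uniform_radius[of UNIV g A \<theta> \<epsilon>] strict \<epsilon>_pos by auto
  show ?thesis
  proof (intro exI[of _ r] conjI r(1) allI impI, elim conjE)
    fix x x' :: "nat \<Rightarrow> 'm \<Rightarrow> 'a" and noise :: "nat \<Rightarrow> 'm \<Rightarrow> 'a" and t :: "nat \<Rightarrow> real" and s
    assume descent: "noisy_descent W g t noise x" "noisy_descent W g t noise x'"
      and init: "\<forall>j. x' 0 j = x 0 j + s *\<^sub>R v"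
      and t: "\<forall>n. 0 < t n \<and> t n \<le> \<Lambda>" "\<not> summable t"
      and in_ball: "\<forall>n j. x n j \<in> ball \<theta> r \<and> x' n j \<in> ball \<theta> r"
    define D where "D n = (\<chi> j. x' n j - x n j)" for n
    define U where "U n = (\<chi> j. g j (x' n j) - g j (x n j))" for n
    have step: "D (Suc n) = mix W (D n - t n *\<^sub>R U n)" for n
      using descent unfolding noisy_descent_def D_def U_def mix_def
      by (simp add: vec_eq_iff algebra_simps flip: sum_subtractf)
    have U: "norm (U n $ j - A j (D n $ j)) \<le> \<epsilon> * norm (D n $ j)" for n j
      using r(2)[of "x n j" "x' n j" j] in_ball by (simp add: U_def D_def)
    have D0: "D 0 = vec (s *\<^sub>R v)"
      by (simp add: D_def init vec_eq_iff)
    have "norm (mean (D n)) \<le> real CARD('m) * (2 * r)" for n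
    proof -
      have "norm (D n $ j) \<le> 2 * r" for j
        using in_ball[rule_format, of n j] dist_triangle[of "x' n j" "x n j" \<theta>]
        by (simp add: D_def dist_norm dist_commute norm_minus_commute)
      then have "(\<Sum>j\<in>(UNIV::'m set). norm (D n $ j)) \<le> real CARD('m) * (2 * r)"
        by (rule sum_bounded_above)
      then show ?thesis
        using norm_mean_le[of "D n"] L2_set_le_sum[of UNIV "\<lambda>i. norm (D n $ i)"] unfolding norm_vec_def by force
    qed
    then have "\<not> q (mean (D 0)) > 0"
      using differences_unbounded[OF step U _ _ _ _ t(2)] t(1) by (auto simp: D0 disagreement_def)
    then show "s = 0"
      using v by (simp add: D0 q_scale zero_less_mult_iff)
  qed
qed

end

section \<open>Null sets of products of absolutely continuous measures\<close>

lemma PiM_density_eq: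
  fixes N :: "'a measure"
  assumes "finite I" "sigma_finite_measure N" "sigma_finite_measure (density N \<phi>)"
    and [measurable]: "\<phi> \<in> borel_measurable N"
  shows "density (PiM I (\<lambda>_. N)) (\<lambda>f. \<Prod>i\<in>I. \<phi> (f i)) = PiM I (\<lambda>_. density N \<phi>)"
proof -
  interpret N: product_sigma_finite "\<lambda>_. N"
    using assms(2) by (simp add: product_sigma_finite_def)
  interpret D: product_sigma_finite "\<lambda>_. density N \<phi>"
    using assms(3) by (simp add: product_sigma_finite_def)
  have prod_\<phi>: "(\<lambda>f. \<Prod>i\<in>I. \<phi> (f i)) \<in> borel_measurable (PiM I (\<lambda>_. N))"
    by measurable
  show ?thesis
  proof (rule D.PiM_eqI[OF \<open>finite I\<close>])
    show "sets (density (PiM I (\<lambda>_. N)) (\<lambda>f. \<Prod>i\<in>I. \<phi> (f i))) = sets (PiM I (\<lambda>_. density N \<phi>))"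
      by (simp cong: sets_PiM_cong)
  next
    fix A assume "\<And>i. i \<in> I \<Longrightarrow> A i \<in> sets (density N \<phi>)"
    then have [measurable]: "\<And>i. i \<in> I \<Longrightarrow> A i \<in> sets N" by simp
    have "Pi\<^sub>E I A \<in> sets (PiM I (\<lambda>_. N))"
      using \<open>finite I\<close> by (intro sets_PiM_I_finite) auto
    then have "emeasure (density (PiM I (\<lambda>_. N)) (\<lambda>f. \<Prod>i\<in>I. \<phi> (f i))) (Pi\<^sub>E I A)
        = (\<integral>\<^sup>+f. (\<Prod>i\<in>I. \<phi> (f i)) * indicator (Pi\<^sub>E I A) f \<partial>PiM I (\<lambda>_. N))"
      by (rule emeasure_density[OF prod_\<phi>])
    also have "\<dots> = (\<integral>\<^sup>+f. (\<Prod>i\<in>I. \<phi> (f i) * indicator (A i) (f i)) \<partial>PiM I (\<lambda>_. N))"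
    proof (intro nn_integral_cong)
      fix f assume "f \<in> space (PiM I (\<lambda>_. N))"
      then have "f \<in> extensional I" by (simp add: space_PiM PiE_def)
      then have "indicator (Pi\<^sub>E I A) f = (\<Prod>i\<in>I. indicator (A i) (f i) :: ennreal)"
        using \<open>finite I\<close> by (auto simp: indicator_def PiE_def Pi_def prod_zero_iff)
      then show "(\<Prod>i\<in>I. \<phi> (f i)) * indicator (Pi\<^sub>E I A) f = (\<Prod>i\<in>I. \<phi> (f i) * indicator (A i) (f i))"
        by (simp add: prod.distrib)
    qed
    also have "\<dots> = (\<Prod>i\<in>I. \<integral>\<^sup>+x. \<phi> x * indicator (A i) x \<partial>N)"
      using \<open>finite I\<close> by (intro N.product_nn_integral_prod) auto
    also have "\<dots> = (\<Prod>i\<in>I. emeasure (density N \<phi>) (A i))"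
      by (intro prod.cong refl emeasure_density[symmetric]) auto
    finally show "emeasure (density (PiM I (\<lambda>_. N)) (\<lambda>f. \<Prod>i\<in>I. \<phi> (f i))) (Pi\<^sub>E I A)
        = (\<Prod>i\<in>I. emeasure (density N \<phi>) (A i))" .
  qed
qed

lemma distr_PiM_lborel_shift:
  fixes w :: "'i \<Rightarrow> 'a::euclidean_space"
  assumes "finite I"
  shows "distr (PiM I (\<lambda>_. lborel)) (PiM I (\<lambda>_. lborel)) (\<lambda>f. \<lambda>i\<in>I. f i + w i) = PiM I (\<lambda>_. lborel)"
proof -
  interpret P: product_sigma_finite "\<lambda>_::'i. lborel :: 'a measure"
    by (simp add: product_sigma_finite_def sigma_finite_lborel)
  have T: "(\<lambda>f. \<lambda>i\<in>I. f i + w i) \<in> PiM I (\<lambda>_. lborel) \<rightarrow>\<^sub>M PiM I (\<lambda>_. lborel)"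
    by (intro measurable_restrict) measurable
  show ?thesis
  proof (rule P.PiM_eqI[OF assms])
    fix A assume A: "\<And>i. i \<in> I \<Longrightarrow> A i \<in> sets (lborel :: 'a measure)"
    have "(\<lambda>f. \<lambda>i\<in>I. f i + w i) -` (Pi\<^sub>E I A) \<inter> space (PiM I (\<lambda>_. lborel))
        = Pi\<^sub>E I (\<lambda>i. (+) (w i) -` A i \<inter> space lborel)"
      by (auto simp: space_PiM PiE_def Pi_def add.commute)
    moreover have pre: "(+) (w i) -` A i \<inter> space lborel \<in> sets lborel" if "i \<in> I" for i
      using A[OF that] by (intro measurable_sets[where A = borel]) auto
    moreover have "emeasure lborel ((+) (w i) -` A i \<inter> space lborel) = emeasure lborel (A i)" if "i \<in> I" for i
      using arg_cong[OF lborel_distr_plus[of "w i"], of "\<lambda>M. emeasure M (A i)"] A[OF that]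
      by (simp add: emeasure_distr)
    ultimately show "emeasure (distr (PiM I (\<lambda>_. lborel)) (PiM I (\<lambda>_. lborel)) (\<lambda>f. \<lambda>i\<in>I. f i + w i)) (Pi\<^sub>E I A)
        = (\<Prod>i\<in>I. emeasure lborel (A i))"
      using assms A by (simp add: emeasure_distr[OF T] sets_PiM_I_finite P.emeasure_PiM)
  qed simp
qed

text \<open>
  Average the measure of the translates of \<open>A\<close> along \<open>w\<close>: by translation invariance the average is
  the measure of \<open>A\<close>, and by Fubini it is the integral of the lengths of the intersections of \<open>A\<close> with
  the lines, which are zero.
\<close>

lemma null_set_if_lines_meet_at_most_once:
  fixes w :: "'i \<Rightarrow> 'a::euclidean_space"
  assumes I: "finite I" and A [measurable]: "A \<in> sets (PiM I (\<lambda>_. borel))"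
    and once: "\<And>f s s'. (\<lambda>i\<in>I. f i + s *\<^sub>R w i) \<in> A \<Longrightarrow> (\<lambda>i\<in>I. f i + s' *\<^sub>R w i) \<in> A \<Longrightarrow> s = s'"
  shows "emeasure (PiM I (\<lambda>_. lborel)) A = 0"
proof -
  let ?P = "PiM I (\<lambda>_. lborel) :: ('i \<Rightarrow> 'a) measure"
  have sets_P: "sets ?P = sets (PiM I (\<lambda>_. borel))" by (intro sets_PiM_cong) auto
  then have AP [measurable]: "A \<in> sets ?P" using A by simp
  interpret P: product_sigma_finite "\<lambda>_::'i. lborel :: 'a measure"
    by (simp add: product_sigma_finite_def sigma_finite_lborel)
  interpret FP: sigma_finite_measure ?P
    by (rule P.sigma_finite[OF I])
  interpret pair_sigma_finite "lborel :: real measure" ?P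
    by (intro pair_sigma_finite.intro sigma_finite_lborel FP.sigma_finite_measure_axioms)
  let ?T = "\<lambda>s f. \<lambda>i\<in>I. f i + s *\<^sub>R w i"
  have T [measurable]: "(\<lambda>(s, f). ?T s f) \<in> lborel \<Otimes>\<^sub>M ?P \<rightarrow>\<^sub>M ?P"
    unfolding split_beta by (intro measurable_restrict) measurable
  let ?F = "\<lambda>s f. indicator {0..1} s * indicator A (?T s f) :: ennreal"
  have F: "case_prod ?F \<in> borel_measurable (lborel \<Otimes>\<^sub>M ?P)"
  proof -
    have "(\<lambda>z. indicator A ((\<lambda>(s, f). ?T s f) z) :: ennreal) \<in> borel_measurable (lborel \<Otimes>\<^sub>M ?P)"
      by measurable
    then have "(\<lambda>z. indicator {0..1} (fst z) * indicator A ((\<lambda>(s, f). ?T s f) z) :: ennreal)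
        \<in> borel_measurable (lborel \<Otimes>\<^sub>M ?P)"
      by measurable
    then show ?thesis by (simp add: split_beta)
  qed
  have "(\<integral>\<^sup>+f. \<integral>\<^sup>+s. ?F s f \<partial>lborel \<partial>?P) = (\<integral>\<^sup>+s. \<integral>\<^sup>+f. ?F s f \<partial>?P \<partial>lborel)"
    by (rule Fubini'[OF F])
  also have "\<dots> = (\<integral>\<^sup>+s. indicator {0..1} s * emeasure ?P A \<partial>(lborel :: real measure))"
  proof (intro nn_integral_cong)
    fix s :: real
    have Ts [measurable]: "?T s \<in> ?P \<rightarrow>\<^sub>M ?P"
      by (intro measurable_restrict) measurable
    have "(\<integral>\<^sup>+f. ?F s f \<partial>?P) = indicator {0..1} s * (\<integral>\<^sup>+f. indicator A (?T s f) \<partial>?P)"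
      by (rule nn_integral_cmult) measurable
    also have "(\<integral>\<^sup>+f. indicator A (?T s f) \<partial>?P) = (\<integral>\<^sup>+f. indicator A f \<partial>distr ?P ?P (?T s))"
      by (rule nn_integral_distr[OF Ts, symmetric]) measurable
    also have "\<dots> = emeasure ?P A"
      using distr_PiM_lborel_shift[OF I, of "\<lambda>i. s *\<^sub>R w i"] by simp
    finally show "(\<integral>\<^sup>+f. ?F s f \<partial>?P) = indicator {0..1} s * emeasure ?P A" .
  qed
  also have "\<dots> = emeasure ?P A"
    by (simp add: nn_integral_multc)
  finally have "emeasure ?P A = (\<integral>\<^sup>+f. \<integral>\<^sup>+s. ?F s f \<partial>lborel \<partial>?P)" by simp
  also have "\<dots> = (\<integral>\<^sup>+f. 0 \<partial>?P)"
  proof (intro nn_integral_cong)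
    fix f
    obtain s0 where s0: "\<And>s. ?T s f \<in> A \<Longrightarrow> s = s0"
      using once by metis
    have "(\<integral>\<^sup>+s. ?F s f \<partial>lborel) \<le> (\<integral>\<^sup>+s. indicator {s0} s \<partial>lborel)"
      by (intro nn_integral_mono) (auto simp: indicator_def dest: s0)
    then show "(\<integral>\<^sup>+s. ?F s f \<partial>lborel) = 0" by simp
  qed
  finally show ?thesis by simp
qed

lemma null_set_of_PiM_density:
  fixes w :: "'i \<Rightarrow> 'a::euclidean_space"
  assumes I: "finite I" and A: "A \<in> sets (PiM I (\<lambda>_. borel))"
    and once: "\<And>f s s'. (\<lambda>i\<in>I. f i + s *\<^sub>R w i) \<in> A \<Longrightarrow> (\<lambda>i\<in>I. f i + s' *\<^sub>R w i) \<in> A \<Longrightarrow> s = s'"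
    and \<phi> [measurable]: "\<phi> \<in> borel_measurable borel" and "prob_space (density lborel \<phi>)"
  shows "emeasure (PiM I (\<lambda>_. density lborel \<phi>)) A = 0"
proof -
  interpret D: prob_space "density lborel \<phi>" by fact
  have sets_P: "sets (PiM I (\<lambda>_. lborel) :: ('i \<Rightarrow> 'a) measure) = sets (PiM I (\<lambda>_. borel))"
    by (intro sets_PiM_cong) auto
  have eq: "PiM I (\<lambda>_. density lborel \<phi>) = density (PiM I (\<lambda>_. lborel)) (\<lambda>f. \<Prod>i\<in>I. \<phi> (f i))"
    by (rule PiM_density_eq[symmetric])
       (use I in \<open>auto intro: sigma_finite_lborel D.sigma_finite_measure_axioms\<close>)
  have "A \<in> null_sets (PiM I (\<lambda>_. lborel))"
    using null_set_if_lines_meet_at_most_once[OF I A once] A sets_P by auto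
  then have "AE f in PiM I (\<lambda>_. lborel). f \<notin> A"
    by (rule AE_not_in)
  then have "A \<in> null_sets (density (PiM I (\<lambda>_. lborel)) (\<lambda>f. \<Prod>i\<in>I. \<phi> (f i)))"
    using A sets_P by (subst null_sets_density_iff) auto
  then show ?thesis unfolding eq by auto
qed

section \<open>Square summable noise and consensus\<close>

lemma multivariate_normal_density_isotropic:
  fixes v :: "real^'d"
  assumes "\<sigma> > 0"
  shows "multivariate_normal_density 0 (\<sigma> *\<^sub>R mat 1) v
    = exp (- ((norm v)\<^sup>2 / (2 * \<sigma>))) / sqrt ((2 * pi) ^ CARD('d) * det (\<sigma> *\<^sub>R mat 1 :: real^'d^'d))"
proof -
  have "matrix_inv (\<sigma> *\<^sub>R mat 1) = ((1 / \<sigma>) *\<^sub>R mat 1 :: real^'d^'d)"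
    unfolding matrix_inv_def
  proof (rule some_equality)
    have mult: "(a *\<^sub>R mat 1) ** (b *\<^sub>R mat 1) = ((a * b) *\<^sub>R mat 1 :: real^'d^'d)" for a b
      by (simp add: matrix_scalar_ac scalar_matrix_assoc flip: scalar_mult_eq_scaleR)
    show "(\<sigma> *\<^sub>R mat 1) ** ((1 / \<sigma>) *\<^sub>R mat 1) = (mat 1 :: real^'d^'d) \<and>
        ((1 / \<sigma>) *\<^sub>R mat 1) ** (\<sigma> *\<^sub>R mat 1) = (mat 1 :: real^'d^'d)"
      using assms by (simp add: mult)
    fix B :: "real^'d^'d"
    assume "(\<sigma> *\<^sub>R mat 1) ** B = mat 1 \<and> B ** (\<sigma> *\<^sub>R mat 1) = mat 1"
    then have "\<sigma> *\<^sub>R B = mat 1"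
      by (simp flip: scalar_matrix_assoc scalar_mult_eq_scaleR)
    then have "(1 / \<sigma>) *\<^sub>R mat 1 = (1 / \<sigma>) *\<^sub>R (\<sigma> *\<^sub>R B)" by simp
    then show "B = (1 / \<sigma>) *\<^sub>R mat 1" using assms by simp
  qed
  then have "inner v (matrix_inv (\<sigma> *\<^sub>R mat 1) *v v) = (norm v)\<^sup>2 / \<sigma>"
    by (simp add: scaleR_matrix_vector_assoc[symmetric] power2_norm_eq_inner)
  then show ?thesis
    by (simp add: multivariate_normal_density_def)
qed

lemma nn_integral_lborel_scale:
  fixes h :: "'a::euclidean_space \<Rightarrow> ennreal"
  assumes [measurable]: "h \<in> borel_measurable borel" and "a > 0"
  shows "(\<integral>\<^sup>+x. h (x /\<^sub>R a) \<partial>lborel) = ennreal (a ^ DIM('a)) * (\<integral>\<^sup>+x. h x \<partial>lborel)"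
proof -
  have "(\<integral>\<^sup>+x. h (x /\<^sub>R a) \<partial>lborel)
      = (\<integral>\<^sup>+x. h (x /\<^sub>R a) \<partial>density (distr lborel borel (\<lambda>x. 0 + a *\<^sub>R x)) (\<lambda>_. \<bar>a\<bar> ^ DIM('a)))"
    using \<open>a > 0\<close> by (subst lborel_affine[of a 0]) auto
  also have "\<dots> = ennreal (a ^ DIM('a)) * (\<integral>\<^sup>+x. h x \<partial>lborel)"
    using \<open>a > 0\<close> by (simp add: nn_integral_density nn_integral_distr nn_integral_cmult)
  finally show ?thesis .
qed

text \<open>
  Since \<open>y \<le> exp y\<close>, the integrand is dominated by a multiple of a rescaled Gaussian, which is integrable
  because the density itself integrates to one.
\<close>

lemma normal_second_moment_finite:
  assumes "\<sigma> > 0"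
    and "prob_space (density lborel (\<lambda>v :: real^'d. ennreal (multivariate_normal_density 0 (\<sigma> *\<^sub>R mat 1) v)))"
  shows "(\<integral>\<^sup>+(v :: real^'d). ennreal (multivariate_normal_density 0 (\<sigma> *\<^sub>R mat 1) v) * ennreal ((norm v)\<^sup>2) \<partial>lborel) < \<infinity>"
proof -
  define Z where "Z = sqrt ((2 * pi) ^ CARD('d) * det (\<sigma> *\<^sub>R mat 1 :: real^'d^'d))"
  define h :: "real^'d \<Rightarrow> ennreal" where "h v = ennreal (exp (- ((norm v)\<^sup>2 / (2 * \<sigma>))))" for v
  have h [measurable]: "h \<in> borel_measurable borel" unfolding h_def by measurable
  have dens: "multivariate_normal_density 0 (\<sigma> *\<^sub>R mat 1) v = (1 / Z) * exp (- ((norm v)\<^sup>2 / (2 * \<sigma>)))" for v :: "real^'d"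
    by (simp add: multivariate_normal_density_isotropic[OF assms(1)] Z_def)
  have dens': "ennreal (multivariate_normal_density 0 (\<sigma> *\<^sub>R mat 1) v) = ennreal (1 / Z) * h v" for v :: "real^'d"
    unfolding dens h_def by (rule ennreal_mult'') simp
  have "ennreal (1 / Z) * (\<integral>\<^sup>+v. h v \<partial>lborel) = 1"
    using prob_space.emeasure_space_1[OF assms(2)]
    by (simp add: emeasure_density dens' nn_integral_cmult)
  then have fin: "(\<integral>\<^sup>+v. h v \<partial>lborel) < \<infinity>"
    by (auto simp: ennreal_mult_eq_top_iff top.not_eq_extremum[symmetric] ennreal_mult_top split: if_splits)
  have bound: "ennreal (multivariate_normal_density 0 (\<sigma> *\<^sub>R mat 1) v) * ennreal ((norm v)\<^sup>2)
      \<le> ennreal (1 / Z) * ennreal (4 * \<sigma>) * h (v /\<^sub>R sqrt 2)" for v :: "real^'d"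
  proof -
    define y where "y = (norm v)\<^sup>2 / (4 * \<sigma>)"
    have y: "(norm v)\<^sup>2 = 4 * \<sigma> * y" "y \<ge> 0" using assms(1) by (simp_all add: y_def)
    have "exp (- ((norm v)\<^sup>2 / (2 * \<sigma>))) * (norm v)\<^sup>2 = 4 * \<sigma> * (exp (- 2 * y) * y)"
      using assms(1) unfolding y(1) by simp
    also have "\<dots> \<le> 4 * \<sigma> * (exp (- 2 * y) * exp y)"
      using assms(1) exp_ge_add_one_self[of y] by (intro mult_left_mono) (auto simp del: exp_ge_add_one_self)
    also have "exp (- 2 * y) * exp y = exp (- ((norm (v /\<^sub>R sqrt 2))\<^sup>2 / (2 * \<sigma>)))"
      using y assms(1) by (simp add: power_mult_distrib power_inverse flip: exp_add)
    finally have "h v * ennreal ((norm v)\<^sup>2) \<le> ennreal (4 * \<sigma>) * h (v /\<^sub>R sqrt 2)"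
      using assms(1) unfolding h_def by (simp add: ennreal_mult[symmetric])
    then show ?thesis
      unfolding dens' by (simp add: mult.assoc mult_left_mono)
  qed
  have "(\<integral>\<^sup>+(v :: real^'d). ennreal (multivariate_normal_density 0 (\<sigma> *\<^sub>R mat 1) v) * ennreal ((norm v)\<^sup>2) \<partial>lborel)
      \<le> (\<integral>\<^sup>+v. ennreal (1 / Z) * ennreal (4 * \<sigma>) * h (v /\<^sub>R sqrt 2) \<partial>lborel)"
    by (intro nn_integral_mono bound)
  also have "\<dots> = ennreal (1 / Z) * ennreal (4 * \<sigma>) * (ennreal (sqrt 2 ^ DIM(real^'d)) * (\<integral>\<^sup>+v. h v \<partial>lborel))"
    by (subst nn_integral_cmult) (simp_all only: nn_integral_lborel_scale[OF h, of "sqrt 2"] real_sqrt_gt_0_iff zero_less_numeral, measurable)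
  also have "\<dots> < \<infinity>"
    using fin by (simp add: ennreal_mult_less_top)
  finally show ?thesis .
qed

lemma contraction_with_vanishing_input_tendsto_0:
  fixes a u :: "nat \<Rightarrow> real"
  assumes step: "\<And>n. a (Suc n) \<le> \<eta> * (a n + u n)" and \<eta>: "0 \<le> \<eta>" "\<eta> < 1"
    and a: "\<And>n. 0 \<le> a n" and u: "u \<longlonglongrightarrow> 0"
  shows "a \<longlonglongrightarrow> 0"
proof (rule LIMSEQ_I)
  fix e :: real assume e: "e > 0"
  have "\<forall>\<^sub>F n in sequentially. u n < (e / 2) * (1 - \<eta>)"
    using e \<eta> by (intro order_tendstoD(2)[OF u]) simp
  then obtain K where K: "\<And>n. n \<ge> K \<Longrightarrow> u n < (e / 2) * (1 - \<eta>)"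
    by (auto simp: eventually_sequentially)
  have decay: "a (K + n) \<le> e / 2 + \<eta> ^ n * a K" for n
  proof (induction n)
    case 0
    then show ?case using e by simp
  next
    case (Suc n)
    have "a (K + Suc n) \<le> \<eta> * a (K + n) + \<eta> * u (K + n)"
      using step[of "K + n"] by (simp add: algebra_simps)
    also have "\<dots> \<le> \<eta> * (e / 2 + \<eta> ^ n * a K) + \<eta> * ((e / 2) * (1 - \<eta>))"
      using Suc \<eta> K[of "K + n"] by (intro add_mono mult_left_mono) auto
    also have "\<eta> * ((e / 2) * (1 - \<eta>)) \<le> (e / 2) * (1 - \<eta>)"
      using e \<eta> by (intro mult_left_le_one_le) auto
    finally show ?case by (simp add: algebra_simps diff_divide_distrib)
  qed
  have "(\<lambda>n. \<eta> ^ n * a K) \<longlonglongrightarrow> 0"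
    using \<eta> by (intro tendsto_mult_left_zero LIMSEQ_power_zero) simp
  then have "\<forall>\<^sub>F n in sequentially. \<eta> ^ n * a K < e / 2"
    using e by (intro order_tendstoD(2)) auto
  then obtain n0 where n0: "\<And>n. n \<ge> n0 \<Longrightarrow> \<eta> ^ n * a K < e / 2"
    by (auto simp: eventually_sequentially)
  have "norm (a n - 0) < e" if "n \<ge> K + n0" for n
  proof -
    have le_diff: "n0 \<le> n - K" using that by simp
    have "a (K + (n - K)) < e" using decay[of "n - K"] n0[OF le_diff] by linarith
    then show ?thesis using that a[of n] by simp
  qed
  then show "\<exists>no. \<forall>n\<ge>no. norm (a n - 0) < e" by blast
qed

lemma iterates_Suc:
  assumes "\<forall>i j. W $ i $ j \<ge> 0"
  shows "iterates W f step noise x0 (Suc k) i = (\<Sum>j\<in>UNIV. W $ i $ j *\<^sub>R (iterates W f step noise x0 k j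
       - step k *\<^sub>R (gradient (f j) (iterates W f step noise x0 k j) + noise k j)))"
  unfolding iterates.simps
  using assms by (intro sum.mono_neutral_left) (auto simp: neighbors_def not_less order.antisym)

lemma iterates_cong:
  assumes "\<And>l j. l < k \<Longrightarrow> noise l j = noise' l j"
  shows "iterates W f step noise x0 k = iterates W f step noise' x0 k"
  using assms by (induction k) (simp_all add: fun_eq_iff)

lemma measurable_iterates:
  fixes noise :: "'z \<Rightarrow> nat \<Rightarrow> 'm::finite \<Rightarrow> 'a::euclidean_space"
  assumes noise: "\<And>k j. (\<lambda>z. noise z k j) \<in> borel_measurable S"
    and gradient: "\<And>j. gradient (f j) \<in> borel_measurable borel"
  shows "(\<lambda>z. iterates W f step (noise z) x0 k i) \<in> borel_measurable S"
proof (induction k arbitrary: i)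
  case (Suc k)
  note [measurable] = Suc noise measurable_compose[OF Suc gradient]
  show ?case by simp
qed simp

text \<open>
  The perturbations \<open>step k *\<^sub>R (gradient + noise)\<close> vanish, so the disagreement is a contraction driven by
  a vanishing input. Hence the convergence of one agent forces the convergence of all the others, and all
  trajectories near a saddle point can be compared in a common neighborhood.
\<close>

lemma agents_reach_consensus:
  fixes f :: "'m::finite \<Rightarrow> 'a::euclidean_space \<Rightarrow> real"
  assumes W: "\<forall>i j. W $ i $ j \<ge> 0" "W *v 1 = 1" "1 v* W = 1"
      "matrix_norm (W - (\<chi> i j. 1 / real CARD('m))) < 1"
    and gradient: "\<And>j u. norm (gradient (f j) u) \<le> G"
    and step: "step \<longlonglongrightarrow> 0"
    and noise: "\<And>j. (\<lambda>k. step k *\<^sub>R noise k j) \<longlonglongrightarrow> 0"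
    and conv: "(\<lambda>k. iterates W f step noise x0 k i) \<longlonglongrightarrow> \<theta>"
  shows "(\<lambda>k. iterates W f step noise x0 k j) \<longlonglongrightarrow> \<theta>"
proof -
  define \<eta> where "\<eta> = matrix_norm (W - (\<chi> i j. 1 / real CARD('m)))"
  have \<eta>: "0 \<le> \<eta>" "\<eta> < 1"
    using W(4) unfolding \<eta>_def matrix_norm_def by (auto intro: onorm_pos_le)
  let ?x = "iterates W f step noise x0"
  define X where "X k = (\<chi> j. ?x k j)" for k
  define U where "U k = (\<chi> j. step k *\<^sub>R (gradient (f j) (?x k j) + noise k j))" for k
  have X: "X (Suc k) = mix W (X k - U k)" for k
    unfolding X_def mix_def U_def iterates_Suc[OF W(1)] by (simp add: vec_eq_iff)
  have "(\<lambda>k. step k *\<^sub>R gradient (f j) (?x k j)) \<longlonglongrightarrow> 0" for j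
  proof (rule Lim_null_comparison)
    show "\<forall>\<^sub>F k in sequentially. norm (step k *\<^sub>R gradient (f j) (?x k j)) \<le> \<bar>step k\<bar> * G"
      using gradient by (intro always_eventually) (auto intro: mult_left_mono)
    show "(\<lambda>k. \<bar>step k\<bar> * G) \<longlonglongrightarrow> 0"
      using step by (intro tendsto_mult_left_zero tendsto_rabs_zero)
  qed
  then have "(\<lambda>k. U k $ j) \<longlonglongrightarrow> 0" for j
    using tendsto_add[OF _ noise[of j]] by (simp add: U_def scaleR_right_distrib)
  then have "U \<longlonglongrightarrow> 0"
    by (intro vec_tendstoI) simp
  then have U0: "(\<lambda>k. norm (U k)) \<longlonglongrightarrow> 0"
    by (rule tendsto_norm_zero)
  have "(\<lambda>k. norm (disagreement (X k))) \<longlonglongrightarrow> 0"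
    by (rule contraction_with_vanishing_input_tendsto_0[OF _ \<eta> _ U0])
       (auto simp: X intro!: disagreement_mix_le W(2,3) \<eta>_def[symmetric])
  then have "(\<lambda>k. disagreement (X k)) \<longlonglongrightarrow> 0"
    by (rule tendsto_norm_zero_cancel)
  then have "(\<lambda>k. disagreement (X k) $ l) \<longlonglongrightarrow> 0" for l
    using tendsto_vec_nth by fastforce
  then have "(\<lambda>k. ?x k i + (disagreement (X k) $ j - disagreement (X k) $ i)) \<longlonglongrightarrow> \<theta> + (0 - 0)"
    by (intro tendsto_intros conv)
  then show ?thesis
    by (simp add: disagreement_def X_def)
qed

text \<open>
  The expected sum of the squared norms is finite, so the sum is finite almost surely.
\<close>

lemma (in prob_space) scaled_noise_tendsto_0:
  fixes X :: "nat \<Rightarrow> 'a \<Rightarrow> 'b::euclidean_space"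
  assumes X: "\<And>k. distributed M lborel (X k) \<phi>"
    and moment: "(\<integral>\<^sup>+v. \<phi> v * ennreal ((norm v)\<^sup>2) \<partial>lborel) < \<infinity>"
    and summable: "summable (\<lambda>k. (t k)\<^sup>2)"
  shows "AE \<omega> in M. (\<lambda>k. t k *\<^sub>R X k \<omega>) \<longlonglongrightarrow> 0"
proof -
  define m2 where "m2 = (\<integral>\<^sup>+v. \<phi> v * ennreal ((norm v)\<^sup>2) \<partial>lborel)"
  have X_meas [measurable]: "X k \<in> borel_measurable M" for k
    using distributed_measurable[OF X[of k]] by simp
  have E: "(\<integral>\<^sup>+\<omega>. ennreal ((norm (t k *\<^sub>R X k \<omega>))\<^sup>2) \<partial>M) = ennreal ((t k)\<^sup>2) * m2" for k
  proof -
    have "(\<integral>\<^sup>+\<omega>. ennreal ((norm (t k *\<^sub>R X k \<omega>))\<^sup>2) \<partial>M)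
        = (\<integral>\<^sup>+\<omega>. ennreal ((t k)\<^sup>2) * ennreal ((norm (X k \<omega>))\<^sup>2) \<partial>M)"
      by (simp add: power_mult_distrib ennreal_mult)
    also have "\<dots> = ennreal ((t k)\<^sup>2) * (\<integral>\<^sup>+\<omega>. ennreal ((norm (X k \<omega>))\<^sup>2) \<partial>M)"
      by (rule nn_integral_cmult) measurable
    also have "(\<integral>\<^sup>+\<omega>. ennreal ((norm (X k \<omega>))\<^sup>2) \<partial>M) = m2"
      unfolding m2_def by (rule distributed_nn_integral[OF X, symmetric]) measurable
    finally show ?thesis .
  qed
  have "(\<integral>\<^sup>+\<omega>. (\<Sum>k. ennreal ((norm (t k *\<^sub>R X k \<omega>))\<^sup>2)) \<partial>M)
      = (\<Sum>k. ennreal ((t k)\<^sup>2) * m2)"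
    by (subst nn_integral_suminf) (simp_all only: E, measurable)
  also have "\<dots> = ennreal (\<Sum>k. (t k)\<^sup>2) * m2"
    using summable by (simp add: ennreal_suminf_multc suminf_ennreal2)
  also have "\<dots> \<noteq> \<infinity>"
    using moment by (simp add: m2_def ennreal_mult_eq_top_iff)
  finally have "AE \<omega> in M. (\<Sum>k. ennreal ((norm (t k *\<^sub>R X k \<omega>))\<^sup>2)) \<noteq> \<infinity>"
    by (intro nn_integral_noteq_infinite) measurable
  then show ?thesis
  proof eventually_elim
    fix \<omega> assume "(\<Sum>k. ennreal ((norm (t k *\<^sub>R X k \<omega>))\<^sup>2)) \<noteq> \<infinity>"
    then have "summable (\<lambda>k. (norm (t k *\<^sub>R X k \<omega>))\<^sup>2)"
      by (intro summable_suminf_not_top) auto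
    then have "(\<lambda>k. (norm (t k *\<^sub>R X k \<omega>))\<^sup>2) \<longlonglongrightarrow> 0"
      by (rule summable_LIMSEQ_zero)
    then have "(\<lambda>k. sqrt ((norm (t k *\<^sub>R X k \<omega>))\<^sup>2)) \<longlonglongrightarrow> sqrt 0"
      by (rule tendsto_real_sqrt)
    then show "(\<lambda>k. t k *\<^sub>R X k \<omega>) \<longlonglongrightarrow> 0"
      by (intro tendsto_norm_zero_cancel[of "\<lambda>k. t k *\<^sub>R X k \<omega>"]) simp
  qed
qed

section \<open>Almost sure avoidance of unstable points\<close>

locale noisy_decentralized_descent = prob_space M for M :: "'w measure" +
  fixes W :: "real^'m^'m" and f :: "'m \<Rightarrow> 'a::euclidean_space \<Rightarrow> real"
    and step :: "nat \<Rightarrow> real" and noise :: "nat \<Rightarrow> 'm \<Rightarrow> 'w \<Rightarrow> 'a" and x0 :: "'m \<Rightarrow> 'a"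
    and \<phi> :: "'a \<Rightarrow> ennreal"
  assumes W_nonneg: "\<forall>i j. W $ i $ j \<ge> 0"
    and rows: "W *v 1 = 1"
    and gradient_borel: "\<And>j. gradient (f j) \<in> borel_measurable borel"
    and step_pos: "\<And>k. step k > 0" and step_null: "step \<longlonglongrightarrow> 0" and not_summable: "\<not> summable step"
    and density: "\<And>k j. distributed M lborel (noise k j) \<phi>"
    and indep: "indep_vars (\<lambda>_. borel) (\<lambda>(k, j). noise k j) UNIV"
begin

abbreviation X :: "'w \<Rightarrow> nat \<Rightarrow> 'm \<Rightarrow> 'a" where
  "X \<omega> \<equiv> iterates W f step (\<lambda>k j. noise k j \<omega>) x0"

lemma noise_borel [measurable]: "noise k j \<in> borel_measurable M"
  using distributed_measurable[OF density[of k j]] by simp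

lemma X_borel [measurable]: "(\<lambda>\<omega>. X \<omega> k i) \<in> borel_measurable M"
  by (rule measurable_iterates) (auto simp: gradient_borel)

lemma \<phi>_borel [measurable]: "\<phi> \<in> borel_measurable borel"
  using distributed_borel_measurable[OF density] by simp

lemma distr_noise: "distr M borel (noise k j) = density lborel \<phi>"
proof -
  have "distr M borel (noise k j) = distr M lborel (noise k j)"
    by (rule distr_cong) auto
  then show ?thesis using distributed_distr_eq_density[OF density] by simp
qed

lemma prob_space_density: "prob_space (density lborel \<phi>)"
  using prob_space_distr[OF noise_borel] distr_noise by metis

text \<open>
  Condition on all noise except that of iteration \<open>k\<close>. By independence, the noise of iteration \<open>k\<close> then
  still has an absolutely continuous law on the product over the agents. An event that each
  line in the direction \<open>(v, \<dots>, v)\<close> meets at most once is therefore null. The first hypothesis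
  says that \<open>Q\<close> is measurable in the noise, on a space of pairs of which one component will hold the
  noise of iteration \<open>k\<close> and the other one the rest.
\<close>

lemma null_set_by_noise_lines:
  fixes Q :: "(nat \<Rightarrow> 'm \<Rightarrow> 'a) \<Rightarrow> bool" and v :: 'a
  assumes Q: "\<And>S (\<xi> :: (nat \<times> 'm \<Rightarrow> 'a) \<times> (nat \<times> 'm \<Rightarrow> 'a) \<Rightarrow> nat \<Rightarrow> 'm \<Rightarrow> 'a).
      (\<And>l j. (\<lambda>z. \<xi> z l j) \<in> borel_measurable S) \<Longrightarrow> {z \<in> space S. Q (\<xi> z)} \<in> sets S"
    and once: "\<And>\<xi> s s'. Q (\<xi>(k := \<lambda>j. \<xi> k j + s *\<^sub>R v)) \<Longrightarrow> Q (\<xi>(k := \<lambda>j. \<xi> k j + s' *\<^sub>R v)) \<Longrightarrow> s = s'"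
  shows "AE \<omega> in M. \<not> Q (\<lambda>l j. noise l j \<omega>)"
proof -
  define I where "I = {k} \<times> (UNIV :: 'm set)"
  let ?N = "\<lambda>(l, j). noise l j"
  let ?P = "\<lambda>J. PiM J (\<lambda>_. borel) :: (nat \<times> 'm \<Rightarrow> 'a) measure"
  define R where "R J \<omega> = restrict (\<lambda>i. ?N i \<omega>) J" for J \<omega>
  have I: "finite I" "I \<noteq> {}" by (auto simp: I_def)
  have N_borel: "?N i \<in> borel_measurable M" for i
    by (cases i) simp
  have R [measurable]: "R J \<in> M \<rightarrow>\<^sub>M ?P J" for J
    unfolding R_def by (intro measurable_restrict N_borel)
  have "indep_var (?P I) (R I) (?P (- I)) (R (- I))"
    unfolding R_def by (rule indep_var_restrict[OF indep]) auto
  then have joint: "distr M (?P I) (R I) \<Otimes>\<^sub>M distr M (?P (- I)) (R (- I))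
      = distr M (?P I \<Otimes>\<^sub>M ?P (- I)) (\<lambda>\<omega>. (R I \<omega>, R (- I) \<omega>))"
    by (simp add: indep_var_distribution_eq)
  have marginal: "distr M (?P I) (R I) = PiM I (\<lambda>_. density lborel \<phi>)"
  proof -
    have "indep_vars (\<lambda>_. borel) ?N I"
      by (rule indep_vars_subset[OF indep]) simp
    then have "distr M (?P I) (R I) = PiM I (\<lambda>i. distr M borel (?N i))"
      unfolding R_def using indep_vars_iff_distr_eq_PiM'[OF I(2), of ?N "\<lambda>_. borel"] N_borel by simp
    also have "\<dots> = PiM I (\<lambda>_. density lborel \<phi>)"
      by (intro PiM_cong refl) (auto simp: distr_noise)
    finally show ?thesis .
  qed
  \<comment> \<open>\<open>\<xi>\<close> reassembles the noise from the two independent parts.\<close>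
  define \<xi> where "\<xi> z l j = (if l = k then fst z (l, j) else snd z (l, j))"
    for z :: "(nat \<times> 'm \<Rightarrow> 'a) \<times> (nat \<times> 'm \<Rightarrow> 'a)" and l j
  define B where "B = {z \<in> space (?P I \<Otimes>\<^sub>M ?P (- I)). Q (\<xi> z)}"
  have B: "B \<in> sets (?P I \<Otimes>\<^sub>M ?P (- I))"
    unfolding B_def
  proof (rule Q)
    fix l j
    show "(\<lambda>z. \<xi> z l j) \<in> borel_measurable (?P I \<Otimes>\<^sub>M ?P (- I))"
    proof (cases "l = k")
      case True
      have "(l, j) \<in> I" using True by (simp add: I_def)
      then have "(\<lambda>z. fst z (l, j)) \<in> borel_measurable (?P I \<Otimes>\<^sub>M ?P (- I))"
        by (rule measurable_compose[OF measurable_fst measurable_component_singleton])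
      then show ?thesis unfolding \<xi>_def using True by simp
    next
      case False
      have "(l, j) \<in> - I" using False by (simp add: I_def)
      then have "(\<lambda>z. snd z (l, j)) \<in> borel_measurable (?P I \<Otimes>\<^sub>M ?P (- I))"
        by (rule measurable_compose[OF measurable_snd measurable_component_singleton])
      then show ?thesis unfolding \<xi>_def using False by simp
    qed
  qed
  interpret P1: prob_space "distr M (?P I) (R I)" by (rule prob_space_distr[OF R])
  interpret P2: prob_space "distr M (?P (- I)) (R (- I))" by (rule prob_space_distr[OF R])
  interpret pair_prob_space "distr M (?P I) (R I)" "distr M (?P (- I)) (R (- I))" ..
  have "emeasure (distr M (?P I \<Otimes>\<^sub>M ?P (- I)) (\<lambda>\<omega>. (R I \<omega>, R (- I) \<omega>))) B
      = (\<integral>\<^sup>+g. emeasure (distr M (?P I) (R I)) ((\<lambda>h. (h, g)) -` B) \<partial>distr M (?P (- I)) (R (- I)))"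
    unfolding joint[symmetric]
    by (rule emeasure_pair_measure_alt2) (use B in \<open>simp cong: sets_pair_measure_cong\<close>)
  also have "\<dots> = (\<integral>\<^sup>+g. 0 \<partial>distr M (?P (- I)) (R (- I)))"
  proof (intro nn_integral_cong)
    fix g
    show "emeasure (distr M (?P I) (R I)) ((\<lambda>h. (h, g)) -` B) = 0"
      unfolding marginal
    proof (rule null_set_of_PiM_density[where w = "\<lambda>_. v"])
      show "(\<lambda>h. (h, g)) -` B \<in> sets (?P I)" by (rule sets_Pair2[OF B])
    next
      fix h s s'
      define h' where "h' = (\<lambda>l j. if l = k then h (l, j) else g (l, j))"
      have *: "\<xi> (\<lambda>i\<in>I. h i + s *\<^sub>R v, g) = h'(k := \<lambda>j. h' k j + s *\<^sub>R v)" for s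
        by (auto simp: \<xi>_def h'_def I_def fun_eq_iff)
      assume "(\<lambda>i\<in>I. h i + s *\<^sub>R v) \<in> (\<lambda>h. (h, g)) -` B" "(\<lambda>i\<in>I. h i + s' *\<^sub>R v) \<in> (\<lambda>h. (h, g)) -` B"
      then show "s = s'"
        unfolding B_def by (intro once[of h' s s']) (simp_all add: *)
    qed (use I prob_space_density in auto)
  qed
  finally have "emeasure M ((\<lambda>\<omega>. (R I \<omega>, R (- I) \<omega>)) -` B \<inter> space M) = 0"
    using B by (subst (asm) emeasure_distr) auto
  moreover have "\<xi> (R I \<omega>, R (- I) \<omega>) = (\<lambda>l j. noise l j \<omega>)" for \<omega>
    by (auto simp: \<xi>_def R_def I_def fun_eq_iff)
  then have "(\<lambda>\<omega>. (R I \<omega>, R (- I) \<omega>)) -` B \<inter> space M = {\<omega> \<in> space M. Q (\<lambda>l j. noise l j \<omega>)}"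
    using measurable_space[OF R] by (auto simp: B_def space_pair_measure)
  moreover have "(\<lambda>\<omega>. (R I \<omega>, R (- I) \<omega>)) -` B \<inter> space M \<in> sets M"
    using B by (intro measurable_sets) auto
  ultimately show ?thesis
    by (intro AE_I'[where N = "{\<omega> \<in> space M. Q (\<lambda>l j. noise l j \<omega>)}"]) auto
qed

text \<open>
  Moving the noise of iteration \<open>k\<close> by \<open>s v\<close> for all agents moves all the states of iteration \<open>k + 1\<close> by
  \<open>- step k s v\<close> and leaves the later noise unchanged. By \<open>trajectories_separate\<close>, at most one \<open>s\<close>
  keeps the states near \<open>\<theta>\<close> from iteration \<open>k + 1\<close> on, so this event is null; then take the union over
  \<open>k\<close>. Small \<open>k\<close> are left out because the stepsizes must be small for the expansion.
\<close>

lemma leaves_neighborhood_of_unstable_point: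
  assumes unstable: "unstable_linearization W A H \<eta> c \<kappa> b L"
    and strict: "\<And>j. strict_derivative (gradient (f j)) (A j) \<theta>"
    and v: "unstable_linearization.q H c v > 0"
  obtains r where "r > 0" "AE \<omega> in M. \<not> (\<forall>\<^sub>F k in sequentially. \<forall>j. X \<omega> k j \<in> ball \<theta> r)"
proof -
  interpret U: unstable_linearization W A H \<eta> c \<kappa> b L by fact
  from U.trajectories_separate[where g = "\<lambda>j. gradient (f j)", OF strict v]
  obtain r where r: "r > 0" and separate: "\<forall>x x' noise t s.
      noisy_descent W (\<lambda>j. gradient (f j)) t noise x \<and> noisy_descent W (\<lambda>j. gradient (f j)) t noise x' \<and>
      (\<forall>j. x' 0 j = x 0 j + s *\<^sub>R v) \<and> (\<forall>n. 0 < t n \<and> t n \<le> U.\<Lambda>) \<and> \<not> summable t \<and>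
      (\<forall>n j. x n j \<in> ball \<theta> r \<and> x' n j \<in> ball \<theta> r) \<longrightarrow> s = 0"
    by (elim exE conjE) (rule that)
  have "\<forall>\<^sub>F k in sequentially. step k < U.\<Lambda>"
    using U.\<Lambda>_pos by (intro order_tendstoD(2)[OF step_null])
  then obtain k0 where k0: "\<And>k. k \<ge> k0 \<Longrightarrow> step k < U.\<Lambda>"
    by (auto simp: eventually_sequentially)
  have "AE \<omega> in M. \<not> (\<forall>n j. X \<omega> (Suc k + n) j \<in> ball \<theta> r)" if k: "k \<ge> k0" for k
  proof (rule null_set_by_noise_lines[where k = k and v = v
        and Q = "\<lambda>\<xi>. \<forall>n j. iterates W f step \<xi> x0 (Suc k + n) j \<in> ball \<theta> r"])
    fix S and \<xi> :: "(nat \<times> 'm \<Rightarrow> 'a) \<times> (nat \<times> 'm \<Rightarrow> 'a) \<Rightarrow> nat \<Rightarrow> 'm \<Rightarrow> 'a"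
    assume "\<And>l j. (\<lambda>z. \<xi> z l j) \<in> borel_measurable S"
    then have [measurable]: "(\<lambda>z. iterates W f step (\<xi> z) x0 n j) \<in> borel_measurable S" for n j
      by (intro measurable_iterates gradient_borel)
    show "{z \<in> space S. \<forall>n j. iterates W f step (\<xi> z) x0 (Suc k + n) j \<in> ball \<theta> r} \<in> sets S"
      unfolding mem_ball by measurable
  next
    fix \<xi> :: "nat \<Rightarrow> 'm \<Rightarrow> 'a" and s s'
    let ?\<xi> = "\<lambda>s. \<xi>(k := \<lambda>j. \<xi> k j + s *\<^sub>R v)"
    let ?x = "\<lambda>s n. iterates W f step (?\<xi> s) x0 (Suc k + n)"
    assume stay: "\<forall>n j. ?x s n j \<in> ball \<theta> r" "\<forall>n j. ?x s' n j \<in> ball \<theta> r"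
    have rec: "noisy_descent W (\<lambda>j. gradient (f j)) (\<lambda>n. step (Suc k + n)) (\<lambda>n. \<xi> (Suc k + n)) (?x u)" for u
      unfolding noisy_descent_def using iterates_Suc[OF W_nonneg, of f step "?\<xi> u" x0 "Suc k + _"] by simp
    have W_sum: "(\<Sum>j\<in>UNIV. W $ i $ j) = 1" for i
      using arg_cong[OF rows, of "\<lambda>v. v $ i"] by (simp add: matrix_vector_mult_def)
    have shift: "?x u 0 i = iterates W f step \<xi> x0 (Suc k) i - (step k * u) *\<^sub>R v" for u i
    proof -
      have same: "iterates W f step (?\<xi> u) x0 k = iterates W f step \<xi> x0 k"
        by (rule iterates_cong) simp
      have "?x u 0 i = (\<Sum>j\<in>UNIV. W $ i $ j *\<^sub>R (iterates W f step \<xi> x0 k j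
          - step k *\<^sub>R (gradient (f j) (iterates W f step \<xi> x0 k j) + \<xi> k j))
          - W $ i $ j *\<^sub>R (step k * u) *\<^sub>R v)"
        using iterates_Suc[OF W_nonneg, of f step "?\<xi> u" x0 k i]
        by (simp only: same add_0_right fun_upd_same) (simp add: algebra_simps)
      also have "\<dots> = iterates W f step \<xi> x0 (Suc k) i - (\<Sum>j\<in>UNIV. W $ i $ j) *\<^sub>R (step k * u) *\<^sub>R v"
        unfolding sum_subtractf iterates_Suc[OF W_nonneg] scaleR_sum_left ..
      finally show ?thesis by (simp add: W_sum)
    qed
    have "step k * (s - s') = 0"
    proof (rule separate[THEN spec[of _ "?x s"], THEN spec[of _ "?x s'"], THEN spec[of _ "\<lambda>n. \<xi> (Suc k + n)"],
          THEN spec[of _ "\<lambda>n. step (Suc k + n)"], THEN spec, THEN mp], intro conjI allI rec)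
      show "?x s' 0 j = ?x s 0 j + (step k * (s - s')) *\<^sub>R v" for j
        unfolding shift by (simp add: algebra_simps)
      show "step (Suc k + n) \<le> U.\<Lambda>" for n
        using k0[of "Suc k + n"] k by simp
      show "\<not> summable (\<lambda>n. step (Suc k + n))"
        using not_summable summable_iff_shift[of step "Suc k"] by (simp add: add.commute)
    qed (use stay step_pos in blast)+
    then show "s = s'" using step_pos[of k] by simp
  qed
  then have "AE \<omega> in M. \<forall>k\<in>{k0..}. \<not> (\<forall>n j. X \<omega> (Suc k + n) j \<in> ball \<theta> r)"
    by (intro AE_ball_countable') auto
  then have "AE \<omega> in M. \<not> (\<forall>\<^sub>F k in sequentially. \<forall>j. X \<omega> k j \<in> ball \<theta> r)"
  proof eventually_elim
    fix \<omega> assume leave: "\<forall>k\<in>{k0..}. \<not> (\<forall>n j. X \<omega> (Suc k + n) j \<in> ball \<theta> r)"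
    show "\<not> (\<forall>\<^sub>F k in sequentially. \<forall>j. X \<omega> k j \<in> ball \<theta> r)"
    proof
      assume "\<forall>\<^sub>F k in sequentially. \<forall>j. X \<omega> k j \<in> ball \<theta> r"
      then obtain k1 where k1: "\<And>k j. k \<ge> k1 \<Longrightarrow> X \<omega> k j \<in> ball \<theta> r"
        by (auto simp: eventually_sequentially)
      have "\<forall>n j. X \<omega> (Suc (max k0 k1) + n) j \<in> ball \<theta> r"
        by (intro allI k1) simp
      then show False using leave by (metis atLeast_iff max.cobounded1)
    qed
  qed
  with r that show ?thesis by blast
qed

end

text \<open>
  The critical points form a closed set. Not being a local extremum is a countable intersection of
  open conditions once the witnesses range over open balls of the radii \<open>1 / (n + 1)\<close>.
\<close>

lemma saddle_points_borel:
  fixes F :: "'a::euclidean_space \<Rightarrow> real"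
  assumes F: "\<And>x. GDERIV F x :> g x" and g: "continuous_on UNIV g"
  shows "{\<theta>. saddle_point F \<theta>} \<in> sets borel"
proof -
  have cont: "continuous_on UNIV F"
    using F unfolding gderiv_def by (auto intro!: continuous_at_imp_continuous_on has_derivative_continuous)
  define lower where "lower n = (\<Union>y. ball y (1 / real (Suc n)) \<inter> {\<theta>. F y < F \<theta>})" for n
  define upper where "upper n = (\<Union>y. ball y (1 / real (Suc n)) \<inter> {\<theta>. F \<theta> < F y})" for n
  have "open (lower n)" "open (upper n)" for n
    unfolding lower_def upper_def
    using cont by (auto intro!: open_UN open_Int open_Collect_less continuous_intros)
  then have meas: "lower n \<in> sets borel" "upper n \<in> sets borel" for n
    by auto
  have gradient_zero: "GDERIV F \<theta> :> 0 \<longleftrightarrow> g \<theta> = 0" for \<theta>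
    using F gradient_eqI by metis
  have "saddle_point F \<theta> \<longleftrightarrow> g \<theta> = 0 \<and> (\<forall>n. \<theta> \<in> lower n) \<and> (\<forall>n. \<theta> \<in> upper n)" for \<theta>
  proof (intro iffI conjI allI)
    assume saddle: "saddle_point F \<theta>"
    then show "g \<theta> = 0" by (simp add: saddle_point_def gradient_zero)
    fix n
    obtain y z where "dist y \<theta> \<le> 1 / (2 * real (Suc n))" "dist z \<theta> \<le> 1 / (2 * real (Suc n))"
        "F y < F \<theta>" "F \<theta> < F z"
      using saddle unfolding saddle_point_def
      by (metis divide_pos_pos mult_pos_pos of_nat_0_less_iff zero_less_Suc zero_less_numeral zero_less_one)
    moreover have "1 / (2 * real (Suc n)) < 1 / real (Suc n)" by (simp add: field_simps)
    ultimately show "\<theta> \<in> lower n" "\<theta> \<in> upper n"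
      unfolding lower_def upper_def by (force)+
  next
    assume near: "g \<theta> = 0 \<and> (\<forall>n. \<theta> \<in> lower n) \<and> (\<forall>n. \<theta> \<in> upper n)"
    show "saddle_point F \<theta>"
      unfolding saddle_point_def gradient_zero
    proof (intro conjI allI impI)
      fix \<gamma> :: real assume "\<gamma> > 0"
      then obtain n where n: "1 / real (Suc n) < \<gamma>"
        using nat_approx_posE by metis
      obtain y z where "\<theta> \<in> ball y (1 / real (Suc n))" "F y < F \<theta>"
          "\<theta> \<in> ball z (1 / real (Suc n))" "F \<theta> < F z"
        using near unfolding lower_def upper_def by blast
      then show "\<exists>\<theta>\<^sub>1 \<theta>\<^sub>2. dist \<theta>\<^sub>1 \<theta> \<le> \<gamma> \<and> dist \<theta>\<^sub>2 \<theta> \<le> \<gamma> \<and> F \<theta>\<^sub>1 < F \<theta> \<and> F \<theta> < F \<theta>\<^sub>2"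
        using n by (intro exI[of _ y] exI[of _ z]) auto
    qed (use near in simp)
  qed
  then have "{\<theta>. saddle_point F \<theta>} = {\<theta>. g \<theta> = 0} \<inter> (\<Inter>n. lower n) \<inter> (\<Inter>n. upper n)"
    by auto
  moreover have "closed {\<theta>. g \<theta> = 0}"
    using g by (intro closed_Collect_eq continuous_intros)
  ultimately show ?thesis
    using meas by auto
qed

section \<open>Strict saddles of the aggregated objective\<close>

lemma unstable_linearization_at_strict_saddle:
  fixes W :: "real^'m^'m" and A :: "'m \<Rightarrow> real^'d \<Rightarrow> real^'d" and H :: "real^'d^'d"
  assumes W: "W *v 1 = 1" "1 v* W = 1" "matrix_norm (W - (\<chi> i j. 1 / real CARD('m))) < 1"
    and A: "\<And>j. bounded_linear (A j)"
    and H: "\<And>y. H *v y = (1 / real CARD('m)) *\<^sub>R (\<Sum>j\<in>UNIV. A j y)"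
    and sym: "\<And>x y. inner (H *v x) y = inner x (H *v y)"
    and neg: "Min (eigenvalues H) < 0"
  obtains \<eta> c \<kappa> b L v where "unstable_linearization W A ((*v) H) \<eta> c \<kappa> b L"
    "unstable_linearization.q ((*v) H) c v > 0"
proof -
  obtain v c \<kappa> where c: "c > 0" and \<kappa>: "\<kappa> > 0" and v: "inner v (H *v v + c *\<^sub>R v) < 0"
    and below: "\<forall>y. \<kappa> * norm y \<le> norm (H *v y + c *\<^sub>R y)"
    by (rule unstable_direction_of_symmetric[OF sym neg]) (rule that)
  define L where "L = (\<Sum>j\<in>UNIV. onorm (A j)) + 1"
  define b where "b = onorm (\<lambda>y. H *v y + c *\<^sub>R y) + 1"
  have A_pos: "0 \<le> onorm (A j)" for j by (rule onorm_pos_le[OF A])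
  have B: "bounded_linear (\<lambda>y. H *v y + c *\<^sub>R y)"
    by (intro bounded_linear_add bounded_linear_scaleR_right) simp
  have unstable: "unstable_linearization W A ((*v) H) (matrix_norm (W - (\<chi> i j. 1 / real CARD('m)))) c \<kappa> b L"
  proof (rule unstable_linearization.intro)
    show "linear (A j)" for j using A bounded_linear.linear by blast
    show "norm (A j y) \<le> L * norm y" for j y
    proof -
      have "onorm (A j) \<le> (\<Sum>j\<in>UNIV. onorm (A j))"
        by (rule member_le_sum) (auto simp: A_pos)
      then have "onorm (A j) * norm y \<le> L * norm y"
        by (intro mult_right_mono) (auto simp: L_def)
      then show ?thesis using onorm[OF A, of j y] by linarith
    qed
    show "L > 0" using A_pos by (simp add: L_def add_nonneg_pos sum_nonneg)
    show "b > 0" using onorm_pos_le[OF B] by (simp add: b_def)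
    show "norm (H *v y + c *\<^sub>R y) \<le> b * norm y" for y
      using onorm[OF B, of y] unfolding b_def distrib_right by (simp add: add_increasing2)
    show "H *v y = mean (\<chi> j. A j y)" for y by (simp add: H mean_def)
  qed (use W sym c \<kappa> below in auto)
  have "unstable_linearization.q ((*v) H) c v > 0"
    using v by (simp add: unstable_linearization.q_def[OF unstable])
  with unstable show ?thesis by (rule that)
qed

lemma gradient_local_objective:
  fixes cost :: "'m \<Rightarrow> 'a::euclidean_space \<Rightarrow> 's \<Rightarrow> real"
  assumes "\<forall>t\<in>dataset s N i. twice_differentiable (\<lambda>\<theta>. cost i \<theta> t)"
  shows "GDERIV (local_objective cost s N i) x :> gradient (local_objective cost s N i) x"
    and "gradient (local_objective cost s N i) x
      = (1 / real (N i)) *\<^sub>R (\<Sum>j=1..N i. gradient (\<lambda>\<theta>. cost i \<theta> (s i j)) x)"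
proof -
  have "GDERIV (\<lambda>\<theta>. (1 / real (N i)) * (\<Sum>j=1..N i. cost i \<theta> (s i j))) x
      :> (1 / real (N i)) *\<^sub>R (\<Sum>j=1..N i. gradient (\<lambda>\<theta>. cost i \<theta> (s i j)) x)"
    using assms by (intro GDERIV_scaled_sum differentiable_imp_GDERIV_gradient)
      (auto simp: dataset_def twice_differentiable_def)
  then have "GDERIV (local_objective cost s N i) x
      :> (1 / real (N i)) *\<^sub>R (\<Sum>j=1..N i. gradient (\<lambda>\<theta>. cost i \<theta> (s i j)) x)"
    by (simp add: local_objective_def[abs_def])
  moreover from this show eq: "gradient (local_objective cost s N i) x
      = (1 / real (N i)) *\<^sub>R (\<Sum>j=1..N i. gradient (\<lambda>\<theta>. cost i \<theta> (s i j)) x)"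
    by (rule gradient_eqI)
  ultimately show "GDERIV (local_objective cost s N i) x :> gradient (local_objective cost s N i) x"
    by simp
qed

theorem theorem3:
  fixes W :: "real^'m^'m"
    and cost :: "'m \<Rightarrow> real^'d \<Rightarrow> real^'p \<Rightarrow> real"
    and s :: "'m \<Rightarrow> nat \<Rightarrow> real^'p"
    and N :: "'m \<Rightarrow> nat"
    and f :: "'m \<Rightarrow> real^'d \<Rightarrow> real"
    and F :: "real^'d \<Rightarrow> real"
    and x0 :: "'m \<Rightarrow> real^'d"
    and M :: "'w measure"
    and noise :: "nat \<Rightarrow> 'm \<Rightarrow> 'w \<Rightarrow> real^'d"
    and \<nu> \<rho> G \<sigma> :: real
  assumes samples_nonempty: "\<forall>i. N i \<ge> 1"
    and f_eq: "f = local_objective cost s N"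
    and F_eq: "F = aggregate_objective f"
    and smooth: "\<forall>i. \<forall>t\<in>dataset s N i. twice_differentiable (\<lambda>\<theta>. cost i \<theta> t)"
    and coercive: "\<forall>i. \<forall>t\<in>dataset s N i. filterlim (\<lambda>\<theta>. cost i \<theta> t) at_top at_infinity"
    and constants_pos: "\<nu> > 0" "\<rho> > 0"
    and gradient_Lipschitz: "\<forall>i. \<forall>t\<in>dataset s N i. \<forall>u v.
      norm (gradient (\<lambda>\<theta>. cost i \<theta> t) u - gradient (\<lambda>\<theta>. cost i \<theta> t) v) \<le> \<nu> * norm (u - v)"
    and hessian_Lipschitz: "\<forall>i. \<forall>t\<in>dataset s N i. \<forall>u v.
      matrix_norm (hessian (\<lambda>\<theta>. cost i \<theta> t) u - hessian (\<lambda>\<theta>. cost i \<theta> t) v) \<le> \<rho> * norm (u - v)"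
    and data_Lipschitz: "\<forall>i. \<forall>t\<in>dataset s N i. \<forall>t'\<in>dataset s N i. \<forall>u.
      l1_norm (gradient (\<lambda>\<theta>. cost i \<theta> t) u - gradient (\<lambda>\<theta>. cost i \<theta> t') u) \<le> \<nu> * l1_norm (t - t')"
    and G_pos: "G > 0"
    and gradient_bounded: "\<forall>i. \<forall>t\<in>dataset s N i. \<forall>u. norm (gradient (\<lambda>\<theta>. cost i \<theta> t) u) \<le> G"
    and W_nonneg: "\<forall>i j. W $ i $ j \<ge> 0"
    and W_diag_pos: "\<forall>i. W $ i $ i > 0"
    and W_symmetric: "transpose W = W"
    and W_column_sums: "1 v* W = 1"
    and W_row_sums: "W *v 1 = 1"
    and W_contraction: "matrix_norm (W - (\<chi> i j. 1 / real CARD('m))) < 1"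
    and saddles_strict: "\<forall>\<theta>. saddle_point F \<theta> \<longrightarrow> strict_saddle F \<theta>"
    and prob: "prob_space M"
    and \<sigma>_pos: "\<sigma> > 0"
    and noise_gaussian: "\<forall>k j. distributed M lborel (noise k j)
      (\<lambda>v. ennreal (multivariate_normal_density 0 (\<sigma> *\<^sub>R mat 1) v))"
    and noise_independent: "prob_space.indep_vars M (\<lambda>_. borel) (\<lambda>(k, j). noise k j) UNIV"
  shows "\<exists>C>0. \<forall>\<mu>. 0 < \<mu> \<and> \<mu> < 1 \<longrightarrow>
    (\<exists>lam0. 0 < lam0 \<and> lam0 \<le> 1 / \<nu> \<and>
      (\<forall>lam K step.
        0 < lam \<and> lam \<le> lam0 \<and>
        K = nat \<lceil>C * ln (1 / \<mu>) / lam\<rceil> \<and>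
        (\<forall>k<K. step k = lam) \<and>
        (\<forall>k\<ge>K. step k > 0) \<and>
        step \<longlonglongrightarrow> 0 \<and>
        \<not> summable (\<lambda>k. step (k + K)) \<and>
        summable (\<lambda>k. (step (k + K))\<^sup>2) \<longrightarrow>
        measure M {\<omega> \<in> space M.
          \<forall>i \<theta>. saddle_point F \<theta> \<longrightarrow>
            \<not> (\<lambda>k. iterates W f step (\<lambda>k j. noise k j \<omega>) x0 k i) \<longlonglongrightarrow> \<theta>} \<ge> 1 - \<mu>))"
proof -
  have sample: "s i j \<in> dataset s N i" if "j \<in> {1..N i}" for i j
    using that by (auto simp: dataset_def)
  note f_gradient = gradient_local_objective[where cost = cost and s = s and N = N, OF smooth[THEN spec], folded f_eq]

  define A where "A \<theta> i u = (1 / real (N i)) *\<^sub>R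
      (\<Sum>j=1..N i. hessian (\<lambda>\<theta>. cost i \<theta> (s i j)) \<theta> *v u)" for \<theta> i u
  have f_strict: "strict_derivative (gradient (f i)) (A \<theta> i) \<theta>" for i \<theta>
  proof -
    have "strict_derivative (\<lambda>x. (1 / real (N i)) *\<^sub>R (\<Sum>j=1..N i. gradient (\<lambda>\<theta>. cost i \<theta> (s i j)) x))
        (A \<theta> i) \<theta>"
      unfolding A_def
      by (intro strict_derivative_scaled_sum strict_derivative_gradient_of_Lipschitz_hessian[OF _ constants_pos(2)])
         (use smooth hessian_Lipschitz sample in auto)
    moreover have "gradient (f i) = (\<lambda>x. (1 / real (N i)) *\<^sub>R (\<Sum>j=1..N i. gradient (\<lambda>\<theta>. cost i \<theta> (s i j)) x))"
      by (rule ext) (rule f_gradient(2))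
    ultimately show ?thesis by metis
  qed
  have gradient_f_le: "norm (gradient (f i) x) \<le> G" for i x
  proof -
    have "norm (\<Sum>j=1..N i. gradient (\<lambda>\<theta>. cost i \<theta> (s i j)) x) \<le> (\<Sum>j=1..N i. G)"
      using gradient_bounded sample by (intro sum_norm_le) auto
    then show ?thesis
      using samples_nonempty[rule_format, of i] by (simp add: f_gradient(2) divide_le_eq mult.commute)
  qed
  have gradient_f_cont: "continuous_on UNIV (gradient (f i))" for i
    using strict_derivative_imp_has_derivative[OF f_strict]
    by (intro continuous_at_imp_continuous_on) (blast intro: has_derivative_continuous)
  then have gradient_f_borel: "gradient (f i) \<in> borel_measurable borel" for i
    by (rule borel_measurable_continuous_onI)

  have F_deriv: "GDERIV F x :> (1 / real CARD('m)) *\<^sub>R (\<Sum>i\<in>UNIV. gradient (f i) x)" for x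
    unfolding F_eq aggregate_objective_def[abs_def]
    by (intro GDERIV_scaled_sum f_gradient(1))
  have gradient_F: "gradient F = (\<lambda>x. (1 / real CARD('m)) *\<^sub>R (\<Sum>i\<in>UNIV. gradient (f i) x))"
    using gradient_eqI[OF F_deriv] by blast
  have F_strict: "strict_derivative (gradient F) (\<lambda>u. (1 / real CARD('m)) *\<^sub>R (\<Sum>i\<in>UNIV. A \<theta> i u)) \<theta>" for \<theta>
    unfolding gradient_F by (intro strict_derivative_scaled_sum f_strict) simp
  have hessian_F: "hessian F \<theta> *v u = (1 / real CARD('m)) *\<^sub>R (\<Sum>i\<in>UNIV. A \<theta> i u)" for \<theta> u
  proof -
    have D: "(gradient F has_derivative (\<lambda>u. (1 / real CARD('m)) *\<^sub>R (\<Sum>i\<in>UNIV. A \<theta> i u))) (at \<theta>)"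
      by (rule strict_derivative_imp_has_derivative[OF F_strict])
    then have "gradient F differentiable at \<theta>" by (auto simp: differentiable_def)
    then have "(gradient F has_derivative (*v) (hessian F \<theta>)) (at \<theta>)"
      by (simp add: hessian_def jacobian_works)
    from has_derivative_unique[OF this D] show ?thesis by (rule fun_cong)
  qed
  have hessian_symmetric: "inner (hessian F \<theta> *v x) y = inner x (hessian F \<theta> *v y)" for \<theta> x y
    unfolding hessian_F
    by (rule strict_derivative_gradient_symmetric[where f = F, OF _ F_strict]) (simp add: gradient_F F_deriv)
  have saddles_borel: "{\<theta>. saddle_point F \<theta>} \<in> sets borel"
    by (rule saddle_points_borel[OF F_deriv]) (intro continuous_intros gradient_f_cont)

  have prob_density: "prob_space (density lborel (\<lambda>v :: real^'d. ennreal (multivariate_normal_density 0 (\<sigma> *\<^sub>R mat 1) v)))"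
    using distributed_distr_eq_density[OF noise_gaussian[rule_format]]
      prob_space.prob_space_distr[OF prob] distributed_measurable[OF noise_gaussian[rule_format]] by metis
  note second_moment = normal_second_moment_finite[OF \<sigma>_pos prob_density]

  have nonconvergence: "measure M {\<omega> \<in> space M. \<forall>i \<theta>. saddle_point F \<theta> \<longrightarrow>
      \<not> (\<lambda>k. iterates W f step (\<lambda>k j. noise k j \<omega>) x0 k i) \<longlonglongrightarrow> \<theta>} = 1"
    if step: "\<And>k. step k > 0" "step \<longlonglongrightarrow> 0" "\<not> summable step" "summable (\<lambda>k. (step k)\<^sup>2)" for step
  proof -
    interpret noisy_decentralized_descent M W f step noise x0
        "\<lambda>v. ennreal (multivariate_normal_density 0 (\<sigma> *\<^sub>R mat 1) v)"
      by (intro noisy_decentralized_descent.intro prob noisy_decentralized_descent_axioms.intro)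
         (use W_nonneg W_row_sums gradient_f_borel step noise_gaussian noise_independent in auto)
    let ?S = "{\<theta>. saddle_point F \<theta>}"
    have "\<forall>\<theta>\<in>?S. \<exists>r. r > 0 \<and> (AE \<omega> in M. \<not> (\<forall>\<^sub>F k in sequentially. \<forall>j. X \<omega> k j \<in> ball \<theta> r))"
    proof
      fix \<theta> assume "\<theta> \<in> ?S"
      have "Min (eigenvalues (hessian F \<theta>)) < 0"
        using saddles_strict \<open>\<theta> \<in> ?S\<close> by (simp add: strict_saddle_def)
      then obtain \<eta> c \<kappa> b L v where unstable: "unstable_linearization W (A \<theta>) ((*v) (hessian F \<theta>)) \<eta> c \<kappa> b L"
          and v: "unstable_linearization.q ((*v) (hessian F \<theta>)) c v > 0"
        by (rule unstable_linearization_at_strict_saddle[OF W_row_sums W_column_sums W_contraction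
            strict_derivative_linear[OF f_strict] hessian_F hessian_symmetric]) (rule that)
      show "\<exists>r. r > 0 \<and> (AE \<omega> in M. \<not> (\<forall>\<^sub>F k in sequentially. \<forall>j. X \<omega> k j \<in> ball \<theta> r))"
        by (rule leaves_neighborhood_of_unstable_point[OF unstable f_strict v]) (intro exI conjI)
    qed
    from bchoice[OF this] obtain r where r: "\<forall>\<theta>\<in>?S. r \<theta> > 0 \<and>
        (AE \<omega> in M. \<not> (\<forall>\<^sub>F k in sequentially. \<forall>j. X \<omega> k j \<in> ball \<theta> (r \<theta>)))"
      by (elim exE) (rule that)
    \<comment> \<open>The saddle points may form a continuum; countably many of the neighborhoods cover them.\<close>
    obtain T where T: "countable T" "T \<subseteq> ?S" "?S \<subseteq> (\<Union>\<theta>\<in>T. ball \<theta> (r \<theta>))"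
    proof -
      obtain \<F> where \<F>: "\<F> \<subseteq> (\<lambda>\<theta>. ball \<theta> (r \<theta>)) ` ?S" "countable \<F>"
          "\<Union>\<F> = \<Union>((\<lambda>\<theta>. ball \<theta> (r \<theta>)) ` ?S)"
        using Lindelof[of "(\<lambda>\<theta>. ball \<theta> (r \<theta>)) ` ?S"] by auto
      then obtain T where T: "countable T" "T \<subseteq> ?S" "\<F> = (\<lambda>\<theta>. ball \<theta> (r \<theta>)) ` T"
        using countable_subset_image[of \<F> "\<lambda>\<theta>. ball \<theta> (r \<theta>)" ?S] by blast
      have "?S \<subseteq> \<Union>((\<lambda>\<theta>. ball \<theta> (r \<theta>)) ` ?S)" using r by auto
      with T \<F>(3) that show ?thesis by metis
    qed
    have "AE \<omega> in M. \<forall>\<theta>\<in>T. \<not> (\<forall>\<^sub>F k in sequentially. \<forall>j. X \<omega> k j \<in> ball \<theta> (r \<theta>))"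
      using T(1,2) r by (intro AE_ball_countable') blast+
    moreover have "AE \<omega> in M. \<forall>j. (\<lambda>k. step k *\<^sub>R noise k j \<omega>) \<longlonglongrightarrow> 0"
      unfolding AE_all_countable
      by (intro allI scaled_noise_tendsto_0[OF _ second_moment step(4)] density)
    ultimately have "AE \<omega> in M. \<forall>i \<theta>. saddle_point F \<theta> \<longrightarrow> \<not> (\<lambda>k. X \<omega> k i) \<longlonglongrightarrow> \<theta>"
    proof eventually_elim
      fix \<omega>
      assume leave: "\<forall>\<theta>\<in>T. \<not> (\<forall>\<^sub>F k in sequentially. \<forall>j. X \<omega> k j \<in> ball \<theta> (r \<theta>))"
        and noise0: "\<forall>j. (\<lambda>k. step k *\<^sub>R noise k j \<omega>) \<longlonglongrightarrow> 0"
      show "\<forall>i \<theta>. saddle_point F \<theta> \<longrightarrow> \<not> (\<lambda>k. X \<omega> k i) \<longlonglongrightarrow> \<theta>"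
      proof (intro allI impI notI)
        fix i \<theta> assume "saddle_point F \<theta>" and conv: "(\<lambda>k. X \<omega> k i) \<longlonglongrightarrow> \<theta>"
        then obtain \<theta>' where \<theta>': "\<theta>' \<in> T" "\<theta> \<in> ball \<theta>' (r \<theta>')" using T(3) by auto
        have "(\<lambda>k. X \<omega> k j) \<longlonglongrightarrow> \<theta>" for j
          by (rule agents_reach_consensus[OF W_nonneg W_row_sums W_column_sums W_contraction
                gradient_f_le step(2) _ conv]) (use noise0 in auto)
        then have "\<forall>\<^sub>F k in sequentially. X \<omega> k j \<in> ball \<theta>' (r \<theta>')" for j
          using \<theta>'(2) by (intro topological_tendstoD) auto
        then have "\<forall>\<^sub>F k in sequentially. \<forall>j. X \<omega> k j \<in> ball \<theta>' (r \<theta>')"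
          by (rule eventually_all_finite)
        with leave \<theta>'(1) show False by blast
      qed
    qed
    moreover have "{\<omega> \<in> space M. \<forall>i \<theta>. saddle_point F \<theta> \<longrightarrow> \<not> (\<lambda>k. X \<omega> k i) \<longlonglongrightarrow> \<theta>} \<in> sets M"
    proof -
      have conv_iff: "(\<forall>\<theta>. saddle_point F \<theta> \<longrightarrow> \<not> u \<longlonglongrightarrow> \<theta>) \<longleftrightarrow> \<not> (Cauchy u \<and> lim u \<in> ?S)"
        for u :: "nat \<Rightarrow> real^'d"
        using Cauchy_convergent_iff convergent_LIMSEQ_iff limI convergentI by (metis mem_Collect_eq)
      note [measurable] = saddles_borel
      show ?thesis unfolding conv_iff by measurable
    qed
    ultimately show ?thesis by (subst prob_Collect_eq_1)
  qed

  \<comment> \<open>The two phases together form a positive, vanishing, square summable stepsize sequence with divergent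
     sum, for which convergence to a saddle point is a null event. So the probability is \<open>1\<close> for
     every \<open>\<mu>\<close>, already with \<open>C = 1\<close> and \<open>lam0 = 1 / \<nu>\<close>.\<close>
  show ?thesis
  proof (rule exI[of _ 1], intro conjI allI impI zero_less_one, rule exI[of _ "1 / \<nu>"], intro conjI allI impI)
    fix \<mu> lam :: real and K :: nat and step :: "nat \<Rightarrow> real"
    assume \<mu>: "0 < \<mu> \<and> \<mu> < 1"
    assume *: "0 < lam \<and> lam \<le> 1 / \<nu> \<and> K = nat \<lceil>1 * ln (1 / \<mu>) / lam\<rceil> \<and> (\<forall>k<K. step k = lam) \<and>
        (\<forall>k\<ge>K. step k > 0) \<and> step \<longlonglongrightarrow> 0 \<and> \<not> summable (\<lambda>k. step (k + K)) \<and>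
        summable (\<lambda>k. (step (k + K))\<^sup>2)"
    have "\<forall>k<K. step k = lam" "\<forall>k\<ge>K. step k > 0" "0 < lam" using * by blast+
    then have "step k > 0" for k by (metis not_less)
    moreover have "\<not> summable step" using * by (simp add: summable_iff_shift)
    moreover have "summable (\<lambda>k. (step k)\<^sup>2)"
      using * summable_iff_shift[of "\<lambda>k. (step k)\<^sup>2" K] by simp
    ultimately have "measure M {\<omega> \<in> space M. \<forall>i \<theta>. saddle_point F \<theta> \<longrightarrow>
      \<not> (\<lambda>k. iterates W f step (\<lambda>k j. noise k j \<omega>) x0 k i) \<longlonglongrightarrow> \<theta>} = 1"
      using * by (intro nonconvergence) auto
    with \<mu> show "measure M {\<omega> \<in> space M. \<forall>i \<theta>. saddle_point F \<theta> \<longrightarrow>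
      \<not> (\<lambda>k. iterates W f step (\<lambda>k j. noise k j \<omega>) x0 k i) \<longlonglongrightarrow> \<theta>} \<ge> 1 - \<mu>"
      by simp
  qed (use constants_pos(1) in auto)
qed

end
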